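(* Let $n>2$ and let $M$ be an $n$-dimensional Riemannian submanifold of the Minkowski space $\mathbb E^{n+2}_1$ lying on $\mathcal{LC}^n\times\mathbb R$, with frame field $\{e_1,\dots,e_n;\theta,\xi\}$ and functions $\alpha,\beta_2,\dots,\beta_n$ as in the context, where $\alpha$ vanishes at no point of $M$. Then $M$ is pseudo-umbilical if and only if $\alpha$ and the $\beta_a$ satisfy $$\beta_2=\beta_3=\cdots=\beta_n=\beta,\qquad e_1(\alpha)+\alpha^2=-\frac{2n-2}{n-2}\,\beta,\qquad e_a(\alpha)=0\quad (a=2,\dots,n)$$ for some function $\beta$.
   Context: $\mathbb E^{m}_1$ is $\mathbb R^m$ with the metric $\langle\cdot,\cdot\rangle=-dx_1^2+\sum_{i=2}^m dx_i^2$. The hypersurface $\mathcal{LC}^n\times\mathbb R\subset\mathbb E^{n+2}_1$ is $\{x: -x_1^2+x_2^2+\cdots+x_{n+1}^2=0,\ x_1>0\}$. For a Riemannian submanifold $M$, $h$, $A$, $\nabla^\perp$ denote the second fundamental form, shape operator and normal connection: $\widetilde\nabla_XY=\nabla_XY+h(X,Y)$, $\widetilde\nabla_X\zeta=-A_\zeta X+\nabla^\perp_X\zeta$. The mean curvature vector field is $H=\frac1n\sum_i h(e_i,e_i)$. $M$ is pseudo-umbilical if there is a smooth function $f$ on $M$ with $\langle A_HX,Y\rangle=f\langle X,Y\rangle$ for all tangent $X,Y$. Frame and invariants. Let $\phi=(\phi_1,\dots,\phi_{n+2})$ be the position vector of $M$. Put $\theta=(\phi_1,\dots,\phi_{n+1},0)$,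 a light-like normal field, and let $\xi$ be the normal field with $\langle\xi,\xi\rangle=0$, $\langle\xi,\theta\rangle=-1$. Let $e_1=(\partial_{x_{n+2}})^T$ be the tangential part of $\partial_{x_{n+2}}$ (a unit vector field), and let $\alpha\in C^\infty(M)$ be defined by $\nabla^\perp_{e_1}\theta=\alpha\theta$, equivalently $\partial_{x_{n+2}}|_M=e_1-\alpha\theta$. Let $D^\perp$ be the orthogonal complement of $\mathrm{span}\{e_1\}$ in $TM$, $\Pi:TM\to D^\perp$ the orthogonal projection, and $L=\Pi\circ A_\xi:D^\perp\to D^\perp$ (self-adjoint). Then $e_2,\dots,e_n$ is an orthonormal frame of $D^\perp$ with $Le_a=\beta_ae_a$, $a=2,\dots,n$. *)

theory Defs
  imports "HOL-Analysis.Analysis"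
begin

text \<open>
  A point of the Minkowski space of dimension \<open>n + 2\<close>, with \<open>n = CARD('n)\<close>, is a triple
  \<open>(x\<^sub>1, (x\<^sub>2, \<dots>, x\<^sub>n\<^sub>+\<^sub>1), x\<^sub>n\<^sub>+\<^sub>2)\<close>.  The type carries its usual Euclidean topology and
  differential structure; the Lorentzian metric is \<open>mink\<close>.
\<close>

type_synonym 'n minkowski = "real \<times> (real ^ 'n) \<times> real"

definition mink :: "'n::finite minkowski \<Rightarrow> 'n minkowski \<Rightarrow> real" where
  "mink u v = - (fst u * fst v) + (\<Sum>i\<in>UNIV. fst (snd u) $ i * fst (snd v) $ i)
     + snd (snd u) * snd (snd v)"

definition light_cone_cylinder :: "'n::finite minkowski set" where
  "light_cone_cylinder = {(t, x, z). - t\<^sup>2 + (\<Sum>i\<in>UNIV. (x $ i)\<^sup>2) = 0 \<and> t > 0}"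

definition last_coord_field :: "'n::finite minkowski" where
  "last_coord_field = (0, 0, 1)"

definition mink_orth_proj :: "'n::finite minkowski set \<Rightarrow> 'n minkowski \<Rightarrow> 'n minkowski" where
  "mink_orth_proj V v = (THE w. w \<in> V \<and> (\<forall>x\<in>V. mink (v - w) x = 0))"

definition mink_orthonormal_basis ::
  "'n::finite minkowski set \<Rightarrow> nat set \<Rightarrow> (nat \<Rightarrow> 'n minkowski) \<Rightarrow> bool" where
  "mink_orthonormal_basis V I b \<longleftrightarrow>
     (\<forall>i\<in>I. b i \<in> V) \<and> (\<forall>i\<in>I. \<forall>j\<in>I. mink (b i) (b j) = (if i = j then 1 else 0)) \<and>
     span (b ` I) = V"

text \<open>Maps of class \<open>C\<^sup>k\<close> and \<open>C\<^sup>\<infinity>\<close> on an open set, by iterated directional derivatives.\<close>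

primrec Ck_on :: "nat \<Rightarrow> 'a::real_normed_vector set \<Rightarrow> ('a \<Rightarrow> 'b::real_normed_vector) \<Rightarrow> bool" where
  "Ck_on 0 S f \<longleftrightarrow> continuous_on S f"
| "Ck_on (Suc k) S f \<longleftrightarrow>
     (\<forall>x\<in>S. f differentiable (at x)) \<and> (\<forall>v. Ck_on k S (\<lambda>x. frechet_derivative f (at x) v))"

definition smooth_on :: "'a::real_normed_vector set \<Rightarrow> ('a \<Rightarrow> 'b::real_normed_vector) \<Rightarrow> bool" where
  "smooth_on S f \<longleftrightarrow> (\<forall>k. Ck_on k S f)"

text \<open>
  An \<open>n\<close>-dimensional immersed submanifold is a topological space \<open>M\<close> with a position vector
  \<open>\<phi>\<close> that is a smooth immersion in suitable local parametrizations.  The smooth structure of \<open>M\<close>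
  is the one determined by \<open>\<phi>\<close>: two local parametrizations in the sense below always differ by a
  diffeomorphism, so no atlas has to be carried around.  Embedded submanifolds are the case in
  which \<open>M\<close> is a subset of Minkowski space and \<open>\<phi> = id\<close>.
\<close>

definition local_param ::
  "'p::topological_space set \<Rightarrow> ('p \<Rightarrow> 'n::finite minkowski) \<Rightarrow> (real ^ 'n) set \<Rightarrow>
     (real ^ 'n \<Rightarrow> 'p) \<Rightarrow> bool" where
  "local_param M \<phi> V \<psi> \<longleftrightarrow>
     open V \<and> openin (top_of_set M) (\<psi> ` V) \<and> (\<exists>g. homeomorphism V (\<psi> ` V) \<psi> g) \<and>
     smooth_on V (\<phi> \<circ> \<psi>) \<and> (\<forall>u\<in>V. inj (frechet_derivative (\<phi> \<circ> \<psi>) (at u)))"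

definition immersed_submanifold ::
  "'p::topological_space set \<Rightarrow> ('p \<Rightarrow> 'n::finite minkowski) \<Rightarrow> bool" where
  "immersed_submanifold M \<phi> \<longleftrightarrow>
     Hausdorff_space (top_of_set M) \<and> second_countable (top_of_set M) \<and>
     (\<forall>p\<in>M. \<exists>V \<psi>. local_param M \<phi> V \<psi> \<and> p \<in> \<psi> ` V)"

definition smooth_map ::
  "'p::topological_space set \<Rightarrow> ('p \<Rightarrow> 'n::finite minkowski) \<Rightarrow>
     ('p \<Rightarrow> 'b::real_normed_vector) \<Rightarrow> bool" where
  "smooth_map M \<phi> Y \<longleftrightarrow> (\<forall>V \<psi>. local_param M \<phi> V \<psi> \<longrightarrow> smooth_on V (Y \<circ> \<psi>))"

definition tangent_space ::
  "'p::topological_space set \<Rightarrow> ('p \<Rightarrow> 'n::finite minkowski) \<Rightarrow> 'p \<Rightarrow> 'n minkowski set" where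
  "tangent_space M \<phi> p =
     {w. \<exists>V \<psi> u h. local_param M \<phi> V \<psi> \<and> u \<in> V \<and> \<psi> u = p \<and>
           w = frechet_derivative (\<phi> \<circ> \<psi>) (at u) h}"

definition riemannian_submanifold ::
  "'p::topological_space set \<Rightarrow> ('p \<Rightarrow> 'n::finite minkowski) \<Rightarrow> bool" where
  "riemannian_submanifold M \<phi> \<longleftrightarrow>
     immersed_submanifold M \<phi> \<and>
     (\<forall>p\<in>M. \<forall>x\<in>tangent_space M \<phi> p. x \<noteq> 0 \<longrightarrow> mink x x > 0)"

text \<open>
  The derivative at \<open>p\<close> of a map \<open>Y\<close> on \<open>M\<close> in the direction of a tangent vector \<open>x\<close>.  For
  real-valued \<open>Y\<close> this is \<open>x(Y)\<close>; for \<open>Y\<close> with values in Minkowski space, i.e. a vector field along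
  \<open>M\<close>, it is the flat connection of the ambient space.
\<close>

definition deriv_along ::
  "'p::topological_space set \<Rightarrow> ('p \<Rightarrow> 'n::finite minkowski) \<Rightarrow> 'p \<Rightarrow> 'n minkowski \<Rightarrow>
     ('p \<Rightarrow> 'b::real_normed_vector) \<Rightarrow> 'b" where
  "deriv_along M \<phi> p x Y =
     (THE d. \<exists>V \<psi> u h. local_param M \<phi> V \<psi> \<and> u \<in> V \<and> \<psi> u = p \<and>
        frechet_derivative (\<phi> \<circ> \<psi>) (at u) h = x \<and> d = frechet_derivative (Y \<circ> \<psi>) (at u) h)"

definition tangential_part ::
  "'p::topological_space set \<Rightarrow> ('p \<Rightarrow> 'n::finite minkowski) \<Rightarrow> 'p \<Rightarrow> 'n minkowski \<Rightarrow>
     'n minkowski" where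
  "tangential_part M \<phi> p v = mink_orth_proj (tangent_space M \<phi> p) v"

definition normal_part ::
  "'p::topological_space set \<Rightarrow> ('p \<Rightarrow> 'n::finite minkowski) \<Rightarrow> 'p \<Rightarrow> 'n minkowski \<Rightarrow>
     'n minkowski" where
  "normal_part M \<phi> p v = v - tangential_part M \<phi> p v"

definition tangent_field ::
  "'p::topological_space set \<Rightarrow> ('p \<Rightarrow> 'n::finite minkowski) \<Rightarrow> ('p \<Rightarrow> 'n minkowski) \<Rightarrow> bool" where
  "tangent_field M \<phi> Y \<longleftrightarrow> smooth_map M \<phi> Y \<and> (\<forall>p\<in>M. Y p \<in> tangent_space M \<phi> p)"

definition normal_field ::
  "'p::topological_space set \<Rightarrow> ('p \<Rightarrow> 'n::finite minkowski) \<Rightarrow> ('p \<Rightarrow> 'n minkowski) \<Rightarrow> bool" where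
  "normal_field M \<phi> \<zeta> \<longleftrightarrow>
     smooth_map M \<phi> \<zeta> \<and> (\<forall>p\<in>M. \<forall>x\<in>tangent_space M \<phi> p. mink (\<zeta> p) x = 0)"

text \<open>
  \<open>h(x, y)\<close> for tangent vectors \<open>x\<close>, \<open>y\<close> at \<open>p\<close>, by the Gauss formula.  Here \<open>y\<close> is extended to a
  tangent vector field, and the value does not depend on the extension.
\<close>

definition second_fundamental_form ::
  "'p::topological_space set \<Rightarrow> ('p \<Rightarrow> 'n::finite minkowski) \<Rightarrow> 'p \<Rightarrow> 'n minkowski \<Rightarrow>
     'n minkowski \<Rightarrow> 'n minkowski" where
  "second_fundamental_form M \<phi> p x y =
     normal_part M \<phi> p (deriv_along M \<phi> p x (SOME Y. tangent_field M \<phi> Y \<and> Y p = y))"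

text \<open>Weingarten formula, for a normal field \<open>\<zeta>\<close> and a tangent vector \<open>x\<close> at \<open>p\<close>.\<close>

definition shape_operator ::
  "'p::topological_space set \<Rightarrow> ('p \<Rightarrow> 'n::finite minkowski) \<Rightarrow> ('p \<Rightarrow> 'n minkowski) \<Rightarrow> 'p \<Rightarrow>
     'n minkowski \<Rightarrow> 'n minkowski" where
  "shape_operator M \<phi> \<zeta> p x = - tangential_part M \<phi> p (deriv_along M \<phi> p x \<zeta>)"

definition normal_connection ::
  "'p::topological_space set \<Rightarrow> ('p \<Rightarrow> 'n::finite minkowski) \<Rightarrow> ('p \<Rightarrow> 'n minkowski) \<Rightarrow> 'p \<Rightarrow>
     'n minkowski \<Rightarrow> 'n minkowski" where
  "normal_connection M \<phi> \<zeta> p x = normal_part M \<phi> p (deriv_along M \<phi> p x \<zeta>)"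

text \<open>The mean curvature vector does not depend on the chosen orthonormal basis.\<close>

definition mean_curvature ::
  "'p::topological_space set \<Rightarrow> ('p \<Rightarrow> 'n::finite minkowski) \<Rightarrow> 'p \<Rightarrow> 'n minkowski" where
  "mean_curvature M \<phi> p =
     (let b = (SOME b. mink_orthonormal_basis (tangent_space M \<phi> p) {1..CARD('n)} b)
      in (1 / real CARD('n)) *\<^sub>R
           (\<Sum>i = 1..CARD('n). second_fundamental_form M \<phi> p (b i) (b i)))"

definition pseudo_umbilical ::
  "'p::topological_space set \<Rightarrow> ('p \<Rightarrow> 'n::finite minkowski) \<Rightarrow> bool" where
  "pseudo_umbilical M \<phi> \<longleftrightarrow>
     (\<exists>f :: 'p \<Rightarrow> real. smooth_map M \<phi> f \<and>
        (\<forall>p\<in>M. \<forall>x\<in>tangent_space M \<phi> p. \<forall>y\<in>tangent_space M \<phi> p.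
           mink (shape_operator M \<phi> (mean_curvature M \<phi>) p x) y = f p * mink x y))"

definition theta_field :: "('p \<Rightarrow> 'n::finite minkowski) \<Rightarrow> 'p \<Rightarrow> 'n minkowski" where
  "theta_field \<phi> p = (fst (\<phi> p), fst (snd (\<phi> p)), 0)"

definition e1_field ::
  "'p::topological_space set \<Rightarrow> ('p \<Rightarrow> 'n::finite minkowski) \<Rightarrow> 'p \<Rightarrow> 'n minkowski" where
  "e1_field M \<phi> p = tangential_part M \<phi> p last_coord_field"

definition D_perp ::
  "'p::topological_space set \<Rightarrow> ('p \<Rightarrow> 'n::finite minkowski) \<Rightarrow> 'p \<Rightarrow> 'n minkowski set" where
  "D_perp M \<phi> p = {x \<in> tangent_space M \<phi> p. mink x (e1_field M \<phi> p) = 0}"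

definition L_operator ::
  "'p::topological_space set \<Rightarrow> ('p \<Rightarrow> 'n::finite minkowski) \<Rightarrow> ('p \<Rightarrow> 'n minkowski) \<Rightarrow> 'p \<Rightarrow>
     'n minkowski \<Rightarrow> 'n minkowski" where
  "L_operator M \<phi> \<xi> p x = mink_orth_proj (D_perp M \<phi> p) (shape_operator M \<phi> \<xi> p x)"

end

theory Submission
  imports Defs
begin

text \<open>
  Write \<open>Z\<close> for the constant field \<open>\<partial>\<^sub>n\<^sub>+\<^sub>2\<close> and \<open>D\<close> for the flat connection.  Since
  \<open>\<theta> = \<phi> - \<langle>\<phi>, Z\<rangle> Z\<close>, we have \<open>D\<^sub>x \<theta> = x - \<langle>x, Z\<rangle> Z\<close> for tangent \<open>x\<close>.  The normal space has
  dimension two, so it is spanned by \<open>\<theta>\<close> and \<open>\<xi>\<close>, and the tangential part of a vector \<open>v\<close> is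
  \<open>v + \<langle>v, \<xi>\<rangle> \<theta> + \<langle>v, \<theta>\<rangle> \<xi>\<close> (lemma \<open>tangential_part_eq\<close>).  In particular \<open>e\<^sub>1 = Z + \<alpha> \<theta>\<close> with
  \<open>\<alpha> = \<langle>Z, \<xi>\<rangle>\<close>.

  Let \<open>B(x, y) = - \<langle>D\<^sub>x \<xi>, y\<rangle> = \<langle>A\<^sub>\<xi> x, y\<rangle>\<close>.  Differentiating the relations \<open>\<langle>\<xi>, Y\<rangle> = \<langle>\<theta>, Y\<rangle> = 0\<close>
  gives \<open>h(x, y) = (\<langle>x, y\<rangle> - \<langle>x, e\<^sub>1\<rangle> \<langle>y, e\<^sub>1\<rangle>) \<xi> - B(x, y) \<theta>\<close>.  Taking the trace,
  \<open>n H = (n - 1) \<xi> - \<tau> \<theta>\<close> with \<open>\<tau> = tr A\<^sub>\<xi>\<close>, and then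
  \<open>n \<langle>A\<^sub>H x, y\<rangle> = (n - 1) B(x, y) + \<tau> (\<langle>x, y\<rangle> - \<langle>x, e\<^sub>1\<rangle> \<langle>y, e\<^sub>1\<rangle>)\<close>
  (lemma \<open>shape_operator_mean_curvature\<close>).  Differentiating \<open>\<alpha> = \<langle>Z, \<xi>\<rangle>\<close> shows
  \<open>B(x, e\<^sub>1) = - (x(\<alpha>) + \<alpha>\<^sup>2 \<langle>x, e\<^sub>1\<rangle>)\<close> (lemma \<open>xi_form_e1\<close>), while \<open>B(e\<^sub>a, e\<^sub>b) = \<beta>\<^sub>a \<delta>\<^sub>a\<^sub>b\<close>.  So with
  \<open>E = e\<^sub>1(\<alpha>) + \<alpha>\<^sup>2\<close>, the matrix of \<open>n A\<^sub>H\<close> in the frame has the entries \<open>- (n - 1) E\<close> at \<open>(1, 1)\<close>,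
  \<open>- (n - 1) e\<^sub>a(\<alpha>)\<close> at \<open>(a, 1)\<close> and \<open>(1, a)\<close>, and \<open>(n - 1) \<beta>\<^sub>a + \<tau>\<close> at \<open>(a, a)\<close>, where
  \<open>\<tau> = - E + \<Sum>\<^sub>a \<beta>\<^sub>a\<close>.  It is a multiple of the identity iff \<open>e\<^sub>a(\<alpha>) = 0\<close>, all \<open>\<beta>\<^sub>a\<close> equal some
  \<open>\<beta>\<close>, and \<open>2 (n - 1) \<beta> = - (n - 2) E\<close>.

  Three points need more than this computation.  Derivatives along \<open>M\<close> have to be independent of the
  chart, which rests on the differentiability of transition maps
  (lemma \<open>has_derivative_lift_through_immersion\<close>).  The symmetry of \<open>B\<close> comes from the symmetry of
  second derivatives of a parametrization (lemma \<open>normal_field_derivative_symmetric\<close>).  Finally, \<open>H\<close>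
  has to be a smooth field and the factor of pseudo-umbilicity a smooth function; both follow from
  the smoothness of derivatives along tangent fields (lemma \<open>smooth_map_deriv_along_field\<close>), for \<open>H\<close>
  after writing \<open>\<tau>\<close> as a sum over a fixed basis of the ambient space
  (lemma \<open>mink_trace_eq_ambient_trace\<close>).
\<close>

section \<open>Calculus of smooth maps on open sets\<close>

text \<open>
  Where one of the maps has no derivative, neither has the other, and both sides are the same
  arbitrary choice.
\<close>

lemma frechet_derivative_cong_open:
  assumes "open S" "x \<in> S" and "\<And>y. y \<in> S \<Longrightarrow> f y = g y"
  shows "frechet_derivative f (at x) = frechet_derivative g (at x)"
proof -
  have "(f has_derivative f') (at x) \<longleftrightarrow> (g has_derivative f') (at x)" for f'
    using has_derivative_transform_within_open[of f f' x UNIV S g]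
      has_derivative_transform_within_open[of g f' x UNIV S f] assms by auto
  then show ?thesis
    by (simp add: frechet_derivative_def)
qed

lemma differentiable_cong_open:
  assumes "open S" "x \<in> S" and "\<And>y. y \<in> S \<Longrightarrow> f y = g y"
  shows "f differentiable at x \<longleftrightarrow> g differentiable at x"
  using has_derivative_transform_within_open[of f _ x UNIV S g]
    has_derivative_transform_within_open[of g _ x UNIV S f] assms
  unfolding differentiable_def by auto

lemma frechet_derivative_eq:
  "(f has_derivative f') (at x) \<Longrightarrow> frechet_derivative f (at x) = f'"
  by (metis frechet_derivative_at)

lemma Ck_on_cong:
  assumes "open S" and "\<And>x. x \<in> S \<Longrightarrow> f x = g x" and "Ck_on k S f"
  shows "Ck_on k S g"
  using assms(2,3)
proof (induction k arbitrary: f g)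
  case 0
  then show ?case using continuous_on_cong[of S S f g] by simp
next
  case (Suc k)
  have "g differentiable at x" if "x \<in> S" for x
    using Suc.prems that differentiable_cong_open[OF assms(1) that, of f g] by simp
  moreover have "Ck_on k S (\<lambda>x. frechet_derivative g (at x) v)" for v
  proof (rule Suc.IH[of "\<lambda>x. frechet_derivative f (at x) v"])
    show "frechet_derivative f (at x) v = frechet_derivative g (at x) v" if "x \<in> S" for x
      using frechet_derivative_cong_open[OF assms(1) that, of f g] Suc.prems(1) by simp
    show "Ck_on k S (\<lambda>x. frechet_derivative f (at x) v)" using Suc.prems(2) by simp
  qed
  ultimately show ?case by simp
qed

lemma Ck_on_Suc_imp:
  "Ck_on (Suc k) S f \<Longrightarrow> Ck_on k S f"
proof (induction k arbitrary: f)
  case 0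
  then show ?case
    by (auto intro!: continuous_at_imp_continuous_on differentiable_imp_continuous_within)
next
  case (Suc k)
  then show ?case by (metis Ck_on.simps(2))
qed

lemma Ck_on_SucI:
  assumes "open S" and "\<And>x. x \<in> S \<Longrightarrow> (f has_derivative f' x) (at x)"
    and "\<And>v. Ck_on k S (\<lambda>x. f' x v)"
  shows "Ck_on (Suc k) S f"
proof -
  have "Ck_on k S (\<lambda>x. frechet_derivative f (at x) v)" for v
    using assms(2) by (intro Ck_on_cong[OF assms(1) _ assms(3)[of v]]) (metis frechet_derivative_eq)
  then show ?thesis
    using assms(2) by (auto simp: differentiable_def)
qed

lemma Ck_on_SucD:
  assumes "Ck_on (Suc k) S f" "x \<in> S"
  shows "(f has_derivative frechet_derivative f (at x)) (at x)"
  using assms by (simp add: frechet_derivative_works)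

lemma Ck_on_const: "open S \<Longrightarrow> Ck_on k S (\<lambda>x. c)"
proof (induction k arbitrary: c)
  case (Suc k)
  then show ?case by (intro Ck_on_SucI[where f'="\<lambda>x v. 0"]) auto
qed simp

lemma Ck_on_add:
  assumes "open S" "Ck_on k S f" "Ck_on k S g"
  shows "Ck_on k S (\<lambda>x. f x + g x)"
  using assms(2,3)
proof (induction k arbitrary: f g)
  case 0
  then show ?case by (simp add: continuous_on_add)
next
  case (Suc k)
  show ?case
    by (rule Ck_on_SucI[OF assms(1) has_derivative_add])
      (use Suc in \<open>auto intro: Ck_on_SucD\<close>)
qed

lemma Ck_on_bounded_linear:
  assumes "open S" "bounded_linear L" "Ck_on k S f"
  shows "Ck_on k S (\<lambda>x. L (f x))"
  using assms(3)
proof (induction k arbitrary: f)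
  case 0
  then show ?case by (simp add: bounded_linear.continuous_on[OF assms(2)])
next
  case (Suc k)
  show ?case
    by (rule Ck_on_SucI[OF assms(1) bounded_linear.has_derivative[OF assms(2)]])
      (use Suc in \<open>auto intro: Ck_on_SucD\<close>)
qed

text \<open>
  By the product rule the derivative of a product is a sum of products of the same kind, so the
  induction on the order of differentiability closes for a fixed bilinear map.
\<close>

lemma Ck_on_bounded_bilinear:
  assumes "open S" "bounded_bilinear B" "Ck_on k S f" "Ck_on k S g"
  shows "Ck_on k S (\<lambda>x. B (f x) (g x))"
  using assms(3,4)
proof (induction k arbitrary: f g)
  case 0
  then show ?case by (simp add: bounded_bilinear.continuous_on[OF assms(2)])
next
  case (Suc k)
  show ?case
  proof (rule Ck_on_SucI[OF assms(1)])
    show "((\<lambda>x. B (f x) (g x)) has_derivative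
        (\<lambda>v. B (f x) (frechet_derivative g (at x) v) + B (frechet_derivative f (at x) v) (g x))) (at x)"
      if "x \<in> S" for x
      using Suc.prems that by (intro bounded_bilinear.FDERIV[OF assms(2)]) (auto intro: Ck_on_SucD)
    show "Ck_on k S (\<lambda>x. B (f x) (frechet_derivative g (at x) v) + B (frechet_derivative f (at x) v) (g x))"
      for v
      using Suc.prems Suc.prems[THEN Ck_on_Suc_imp] by (intro Ck_on_add Suc.IH assms(1)) auto
  qed
qed

lemma Ck_on_inverse:
  fixes f :: "'a::real_normed_vector \<Rightarrow> real"
  assumes "open S" "Ck_on k S f" and "\<And>x. x \<in> S \<Longrightarrow> f x \<noteq> 0"
  shows "Ck_on k S (\<lambda>x. inverse (f x))"
  using assms(2)
proof (induction k)
  case 0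
  then show ?case using assms(3) by (simp add: continuous_on_inverse)
next
  case (Suc k)
  have IH: "Ck_on k S (\<lambda>x. inverse (f x))"
    using Suc Ck_on_Suc_imp by blast
  show ?case
  proof (rule Ck_on_SucI[OF assms(1)])
    show "((\<lambda>x. inverse (f x)) has_derivative
        (\<lambda>v. - (inverse (f x) * frechet_derivative f (at x) v * inverse (f x)))) (at x)"
      if "x \<in> S" for x
      using Suc.prems assms(3) that by (intro Deriv.has_derivative_inverse Ck_on_SucD) auto
    show "Ck_on k S (\<lambda>x. - (inverse (f x) * frechet_derivative f (at x) v * inverse (f x)))" for v
      using Suc.prems IH
      by (intro Ck_on_bounded_linear[OF assms(1) bounded_linear_minus[OF bounded_linear_ident]]
          Ck_on_bounded_bilinear[OF assms(1) bounded_bilinear_mult]) auto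
  qed
qed

lemma smooth_on_cong:
  "open S \<Longrightarrow> (\<And>x. x \<in> S \<Longrightarrow> f x = g x) \<Longrightarrow> smooth_on S f \<Longrightarrow> smooth_on S g"
  unfolding smooth_on_def using Ck_on_cong by blast

lemma smooth_on_const: "open S \<Longrightarrow> smooth_on S (\<lambda>x. c)"
  by (simp add: smooth_on_def Ck_on_const)

lemma smooth_on_add:
  "open S \<Longrightarrow> smooth_on S f \<Longrightarrow> smooth_on S g \<Longrightarrow> smooth_on S (\<lambda>x. f x + g x)"
  by (simp add: smooth_on_def Ck_on_add)

lemma smooth_on_bounded_linear:
  "open S \<Longrightarrow> bounded_linear L \<Longrightarrow> smooth_on S f \<Longrightarrow> smooth_on S (\<lambda>x. L (f x))"
  by (simp add: smooth_on_def Ck_on_bounded_linear)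

lemma smooth_on_bounded_bilinear:
  "open S \<Longrightarrow> bounded_bilinear B \<Longrightarrow> smooth_on S f \<Longrightarrow> smooth_on S g \<Longrightarrow>
    smooth_on S (\<lambda>x. B (f x) (g x))"
  by (simp add: smooth_on_def Ck_on_bounded_bilinear)

lemma smooth_on_inverse:
  fixes f :: "'a::real_normed_vector \<Rightarrow> real"
  shows "open S \<Longrightarrow> smooth_on S f \<Longrightarrow> (\<And>x. x \<in> S \<Longrightarrow> f x \<noteq> 0) \<Longrightarrow>
    smooth_on S (\<lambda>x. inverse (f x))"
  by (simp add: smooth_on_def Ck_on_inverse)

lemma smooth_on_sum:
  assumes "open S" "\<And>i. i \<in> I \<Longrightarrow> smooth_on S (f i)"
  shows "smooth_on S (\<lambda>x. \<Sum>i\<in>I. f i x)"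
  using assms(2)
  by (induction I rule: infinite_finite_induct) (auto intro: smooth_on_const smooth_on_add assms(1))

lemma smooth_on_prod:
  fixes f :: "'i \<Rightarrow> 'a::real_normed_vector \<Rightarrow> real"
  assumes "open S" "\<And>i. i \<in> I \<Longrightarrow> smooth_on S (f i)"
  shows "smooth_on S (\<lambda>x. \<Prod>i\<in>I. f i x)"
  using assms(2)
  by (induction I rule: infinite_finite_induct)
    (auto intro: smooth_on_const smooth_on_bounded_bilinear[OF assms(1) bounded_bilinear_mult] assms(1))

lemma smooth_on_det:
  fixes A :: "'a::real_normed_vector \<Rightarrow> real ^ 'n ^ 'n"
  assumes "open S" "\<And>i j. smooth_on S (\<lambda>x. A x $ i $ j)"
  shows "smooth_on S (\<lambda>x. det (A x))"
  unfolding det_def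
  by (intro smooth_on_sum smooth_on_bounded_bilinear[OF _ bounded_bilinear_mult] smooth_on_const
      smooth_on_prod assms)

text \<open>Cramer's rule exhibits the solution as a quotient of polynomials in the data.\<close>

lemma smooth_on_linear_system_solution:
  fixes A :: "'a::real_normed_vector \<Rightarrow> real ^ 'n ^ 'n" and x :: "'a \<Rightarrow> real ^ 'n"
  assumes S: "open S" and A: "\<And>i j. smooth_on S (\<lambda>u. A u $ i $ j)"
    and b: "\<And>i. smooth_on S (\<lambda>u. b u $ i)"
    and det: "\<And>u. u \<in> S \<Longrightarrow> det (A u) \<noteq> 0" and eq: "\<And>u. u \<in> S \<Longrightarrow> A u *v x u = b u"
  shows "smooth_on S (\<lambda>u. x u $ k)"
proof (rule smooth_on_cong[OF S])
  let ?C = "\<lambda>u. (\<chi> i j. if j = k then b u $ i else A u $ i $ j) :: real ^ 'n ^ 'n"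
  show "det (?C u) * inverse (det (A u)) = x u $ k" if "u \<in> S" for u
    using cramer[OF det[OF that], of "x u" "b u"] eq[OF that] by (simp add: divide_inverse)
  have "smooth_on S (\<lambda>u. if j = k then b u $ i else A u $ i $ j)" for i j
    using A b by (cases "j = k") auto
  then show "smooth_on S (\<lambda>u. det (?C u) * inverse (det (A u)))"
    by (intro smooth_on_bounded_bilinear[OF S bounded_bilinear_mult] smooth_on_inverse smooth_on_det
        S A det) auto
qed

lemma smooth_on_has_derivative:
  "smooth_on S f \<Longrightarrow> x \<in> S \<Longrightarrow> (f has_derivative frechet_derivative f (at x)) (at x)"
  unfolding smooth_on_def using Ck_on_SucD[of 0 S f x] by blast

lemma smooth_on_derivative:
  "smooth_on S f \<Longrightarrow> smooth_on S (\<lambda>x. frechet_derivative f (at x) v)"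
  by (metis Ck_on.simps(2) smooth_on_def)

lemma smooth_on_imp_continuous_on: "smooth_on S f \<Longrightarrow> continuous_on S f"
  by (metis Ck_on.simps(1) smooth_on_def)

text \<open>
  The mean value theorem is applied to \<open>r \<mapsto> f (u + r v + t w) - f (u + r v)\<close> and then, in the
  direction \<open>w\<close>, to the derivative of \<open>f\<close> along \<open>v\<close>.  As the second difference on the left-hand side
  is symmetric in \<open>v\<close> and \<open>w\<close>, letting \<open>t\<close> tend to 0 shows that iterated derivatives commute.
\<close>

lemma second_difference_mvt:
  fixes f :: "'a::real_normed_vector \<Rightarrow> real"
  assumes f: "smooth_on S f" and t: "t > 0"
    and sub: "\<And>r s. \<lbrakk>0 \<le> r; r \<le> t; 0 \<le> s; s \<le> t\<rbrakk> \<Longrightarrow> u + r *\<^sub>R v + s *\<^sub>R w \<in> S"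
  shows "\<exists>r s. 0 \<le> r \<and> r \<le> t \<and> 0 \<le> s \<and> s \<le> t \<and>
     f (u + t *\<^sub>R v + t *\<^sub>R w) - f (u + t *\<^sub>R v) - f (u + t *\<^sub>R w) + f u =
       t\<^sup>2 * frechet_derivative (\<lambda>x. frechet_derivative f (at x) v) (at (u + r *\<^sub>R v + s *\<^sub>R w)) w"
proof -
  let ?D = "\<lambda>x. frechet_derivative f (at x)"
  let ?E = "\<lambda>x. frechet_derivative (\<lambda>y. ?D y v) (at x)"
  have lin: "linear (?D x)" "linear (?E x)" if "x \<in> S" for x
    using smooth_on_has_derivative[OF f that]
      smooth_on_has_derivative[OF smooth_on_derivative[OF f] that] has_derivative_linear by blast+
  have sub': "u + r *\<^sub>R v \<in> S" if "0 \<le> r" "r \<le> t" for r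
    using sub[of r 0] that t by simp
  have "\<exists>r\<in>{0..t}. (f (u + t *\<^sub>R v + t *\<^sub>R w) - f (u + t *\<^sub>R v))
        - (f (u + 0 *\<^sub>R v + t *\<^sub>R w) - f (u + 0 *\<^sub>R v))
      = ?D (u + r *\<^sub>R v + t *\<^sub>R w) ((t - 0) *\<^sub>R v) - ?D (u + r *\<^sub>R v) ((t - 0) *\<^sub>R v)"
  proof (rule mvt_very_simple[where f="\<lambda>r. f (u + r *\<^sub>R v + t *\<^sub>R w) - f (u + r *\<^sub>R v)"
        and f'="\<lambda>r h. ?D (u + r *\<^sub>R v + t *\<^sub>R w) (h *\<^sub>R v) - ?D (u + r *\<^sub>R v) (h *\<^sub>R v)"])
    fix r :: real assume r: "0 \<le> r" "r \<le> t"
    have "((\<lambda>r. f (u + r *\<^sub>R v + t *\<^sub>R w)) has_derivative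
        (\<lambda>h. ?D (u + r *\<^sub>R v + t *\<^sub>R w) (h *\<^sub>R v))) (at r within {0..t})"
      by (rule has_derivative_compose[where f="\<lambda>r. u + r *\<^sub>R v + t *\<^sub>R w" and g=f,
            OF _ smooth_on_has_derivative[OF f sub[OF r less_imp_le[OF t] order_refl]]])
        (use r t in \<open>auto intro!: derivative_eq_intros\<close>)
    moreover have "((\<lambda>r. f (u + r *\<^sub>R v)) has_derivative
        (\<lambda>h. ?D (u + r *\<^sub>R v) (h *\<^sub>R v))) (at r within {0..t})"
      by (rule has_derivative_compose[where f="\<lambda>r. u + r *\<^sub>R v" and g=f,
            OF _ smooth_on_has_derivative[OF f sub'[OF r]]])
        (use r t in \<open>auto intro!: derivative_eq_intros\<close>)
    ultimately show "((\<lambda>r. f (u + r *\<^sub>R v + t *\<^sub>R w) - f (u + r *\<^sub>R v)) has_derivative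
        (\<lambda>h. ?D (u + r *\<^sub>R v + t *\<^sub>R w) (h *\<^sub>R v) - ?D (u + r *\<^sub>R v) (h *\<^sub>R v)))
        (at r within {0..t})"
      by (rule has_derivative_diff)
  qed (use t in simp)
  then obtain r where r: "0 \<le> r" "r \<le> t" and
    req: "f (u + t *\<^sub>R v + t *\<^sub>R w) - f (u + t *\<^sub>R v) - f (u + t *\<^sub>R w) + f u =
      t * (?D (u + r *\<^sub>R v + t *\<^sub>R w) v - ?D (u + r *\<^sub>R v) v)"
    using lin(1)[OF sub] lin(1)[OF sub'] t by (auto simp: linear_cmul algebra_simps)
  have "\<exists>s\<in>{0..t}. ?D (u + r *\<^sub>R v + t *\<^sub>R w) v - ?D (u + r *\<^sub>R v + 0 *\<^sub>R w) v
      = ?E (u + r *\<^sub>R v + s *\<^sub>R w) ((t - 0) *\<^sub>R w)"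
  proof (rule mvt_very_simple[where f="\<lambda>s. ?D (u + r *\<^sub>R v + s *\<^sub>R w) v"
        and f'="\<lambda>s h. ?E (u + r *\<^sub>R v + s *\<^sub>R w) (h *\<^sub>R w)"])
    fix s :: real assume s: "0 \<le> s" "s \<le> t"
    show "((\<lambda>s. ?D (u + r *\<^sub>R v + s *\<^sub>R w) v) has_derivative
        (\<lambda>h. ?E (u + r *\<^sub>R v + s *\<^sub>R w) (h *\<^sub>R w))) (at s within {0..t})"
      by (rule has_derivative_compose[where f="\<lambda>s. u + r *\<^sub>R v + s *\<^sub>R w" and g="\<lambda>y. ?D y v",
            OF _ smooth_on_has_derivative[OF smooth_on_derivative[OF f] sub[OF r s]]])
        (use r s in \<open>auto intro!: derivative_eq_intros\<close>)
  qed (use t in simp)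
  then obtain s where s: "0 \<le> s" "s \<le> t" and
    seq: "?D (u + r *\<^sub>R v + t *\<^sub>R w) v - ?D (u + r *\<^sub>R v) v = t * ?E (u + r *\<^sub>R v + s *\<^sub>R w) w"
    using lin(2)[OF sub] r by (auto simp: linear_cmul)
  show ?thesis
    using r s req seq by (intro exI[of _ r] exI[of _ s]) (simp add: power2_eq_square)
qed

lemma smooth_on_second_derivative_symmetric:
  fixes f :: "'a::real_normed_vector \<Rightarrow> real"
  assumes S: "open S" and f: "smooth_on S f" and u: "u \<in> S"
  shows "frechet_derivative (\<lambda>x. frechet_derivative f (at x) v) (at u) w =
    frechet_derivative (\<lambda>x. frechet_derivative f (at x) w) (at u) v" (is "?E v w u = ?E w v u")
proof (rule ccontr)
  assume ne: "?E v w u \<noteq> ?E w v u"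
  define \<epsilon> where "\<epsilon> = \<bar>?E v w u - ?E w v u\<bar> / 2"
  have \<epsilon>: "\<epsilon> > 0" using ne by (simp add: \<epsilon>_def)
  have "continuous_on S (?E v w)" "continuous_on S (?E w v)"
    by (intro smooth_on_imp_continuous_on smooth_on_derivative f)+
  then have "isCont (?E v w) u" "isCont (?E w v) u"
    using S u continuous_on_eq_continuous_at by blast+
  then obtain d1 d2 where d: "d1 > 0" "d2 > 0"
    "\<And>x. dist x u < d1 \<Longrightarrow> dist (?E v w x) (?E v w u) < \<epsilon>"
    "\<And>x. dist x u < d2 \<Longrightarrow> dist (?E w v x) (?E w v u) < \<epsilon>"
    using \<epsilon> unfolding continuous_at_eps_delta by metis
  obtain d0 where d0: "d0 > 0" "ball u d0 \<subseteq> S"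
    using S u open_contains_ball by blast
  define d where "d = min d0 (min d1 d2)"
  have dpos: "d > 0" using d d0 by (simp add: d_def)
  \<comment> \<open>With \<open>t = d / (2 N)\<close> the whole parallelogram with sides \<open>t v\<close>, \<open>t w\<close> lies in the ball of
    radius \<open>d\<close>; the summand 1 keeps \<open>N\<close> positive.\<close>
  define N where "N = norm v + norm w + 1"
  have N: "N > 0" by (simp add: N_def add_nonneg_pos)
  define t where "t = d / (2 * N)"
  have t: "t > 0" using dpos N by (simp add: t_def)
  have near: "dist (u + r *\<^sub>R a + s *\<^sub>R b) u < d"
    if "0 \<le> r" "r \<le> t" "0 \<le> s" "s \<le> t" "norm a + norm b \<le> N" for r s a b
  proof -
    have "dist (u + r *\<^sub>R a + s *\<^sub>R b) u = norm (r *\<^sub>R a + s *\<^sub>R b)"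
      by (simp add: dist_norm algebra_simps)
    also have "\<dots> \<le> r * norm a + s * norm b"
      using that by (intro norm_triangle_le) simp
    also have "\<dots> \<le> t * norm a + t * norm b"
      using that by (intro add_mono mult_right_mono) auto
    also have "\<dots> \<le> t * N"
      using that t by (simp flip: distrib_left)
    also have "\<dots> < d"
      using dpos N by (simp add: t_def)
    finally show ?thesis .
  qed
  have sub: "u + r *\<^sub>R a + s *\<^sub>R b \<in> S"
    if "0 \<le> r" "r \<le> t" "0 \<le> s" "s \<le> t" "norm a + norm b \<le> N" for r s a b
    using near[OF that] d0 by (auto simp: d_def dist_commute)
  have vw: "norm v + norm w \<le> N" "norm w + norm v \<le> N" by (auto simp: N_def)
  obtain r s where rs: "0 \<le> r" "r \<le> t" "0 \<le> s" "s \<le> t"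
    "f (u + t *\<^sub>R v + t *\<^sub>R w) - f (u + t *\<^sub>R v) - f (u + t *\<^sub>R w) + f u =
      t\<^sup>2 * ?E v w (u + r *\<^sub>R v + s *\<^sub>R w)"
    using second_difference_mvt[OF f t sub[OF _ _ _ _ vw(1)]] by auto
  obtain r' s' where rs': "0 \<le> r'" "r' \<le> t" "0 \<le> s'" "s' \<le> t"
    "f (u + t *\<^sub>R w + t *\<^sub>R v) - f (u + t *\<^sub>R w) - f (u + t *\<^sub>R v) + f u =
      t\<^sup>2 * ?E w v (u + r' *\<^sub>R w + s' *\<^sub>R v)"
    using second_difference_mvt[OF f t sub[OF _ _ _ _ vw(2)]] by auto
  have "t\<^sup>2 * ?E v w (u + r *\<^sub>R v + s *\<^sub>R w) = t\<^sup>2 * ?E w v (u + r' *\<^sub>R w + s' *\<^sub>R v)"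
    using rs(5) rs'(5) by (simp add: algebra_simps)
  then have eq: "?E v w (u + r *\<^sub>R v + s *\<^sub>R w) = ?E w v (u + r' *\<^sub>R w + s' *\<^sub>R v)"
    using t by simp
  have "dist (?E v w (u + r *\<^sub>R v + s *\<^sub>R w)) (?E v w u) < \<epsilon>"
    using near[OF rs(1-4) vw(1)] by (intro d(3)) (simp add: d_def)
  moreover have "dist (?E w v (u + r' *\<^sub>R w + s' *\<^sub>R v)) (?E w v u) < \<epsilon>"
    using near[OF rs'(1-4) vw(2)] by (intro d(4)) (simp add: d_def)
  ultimately have "dist (?E v w u) (?E w v u) < \<epsilon> + \<epsilon>"
    using eq dist_triangle_less_add[of "?E v w u" _ \<epsilon> "?E w v u" \<epsilon>] by (metis dist_commute)
  then show False
    by (simp add: \<epsilon>_def dist_real_def)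
qed

text \<open>
  The point of this lemma is that \<open>g\<close> is only assumed continuous: it makes transition maps between
  parametrizations differentiable.  Since \<open>Q \<circ> f\<close> has the identity as its derivative,
  \<open>Q (f (g y)) - Q (f (g x))\<close> controls \<open>g y - g x\<close> up to half of its own size.
\<close>

lemma has_derivative_lift_through_immersion:
  fixes f :: "'b::real_normed_vector \<Rightarrow> 'c::real_normed_vector" and g :: "'a::real_normed_vector \<Rightarrow> 'b"
  assumes f: "(f has_derivative f') (at (g x))" and Q: "bounded_linear Q" "\<And>v. Q (f' v) = v"
    and g: "isCont g x" and fg: "((\<lambda>y. f (g y)) has_derivative k') (at x)"
  shows "(g has_derivative (\<lambda>v. Q (k' v))) (at x)"
proof -
  let ?R = "\<lambda>z. Q (f z) - Q (f (g x)) - (z - g x)"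
  have Qf: "((\<lambda>z. Q (f z)) has_derivative (\<lambda>v. v)) (at (g x))"
    using bounded_linear.has_derivative[OF Q(1) f] Q(2) by simp
  have Qfg: "((\<lambda>y. Q (f (g y))) has_derivative (\<lambda>v. Q (k' v))) (at x)"
    by (rule bounded_linear.has_derivative[OF Q(1) fg])
  then have bl: "bounded_linear (\<lambda>v. Q (k' v))" by (rule has_derivative_bounded_linear)
  then obtain K where K: "K > 0" "\<And>v. norm (Q (k' v)) \<le> norm v * K"
    using bounded_linear.pos_bounded by blast
  have remf: "\<forall>\<^sub>F y in at x. norm (?R (g y)) \<le> e * norm (g y - g x)" if e: "e > 0" for e
  proof -
    obtain d where "d > 0" and d: "\<And>z. norm (z - g x) < d \<Longrightarrow> norm (?R z) \<le> e * norm (z - g x)"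
      using conjunct2[OF Qf[unfolded has_derivative_at_alt], rule_format, OF e] by blast
    have "\<forall>\<^sub>F y in at x. dist (g y) (g x) < d"
      using g \<open>d > 0\<close> unfolding isCont_def tendsto_iff by blast
    then show ?thesis by eventually_elim (use d in \<open>simp add: dist_norm\<close>)
  qed
  have remg: "\<forall>\<^sub>F y in at x. norm (Q (f (g y)) - Q (f (g x)) - Q (k' (y - x))) \<le> e * norm (y - x)"
    if e: "e > 0" for e
  proof -
    obtain d where "d > 0" and d: "\<And>y. norm (y - x) < d \<Longrightarrow>
        norm (Q (f (g y)) - Q (f (g x)) - Q (k' (y - x))) \<le> e * norm (y - x)"
      using conjunct2[OF Qfg[unfolded has_derivative_at_alt], rule_format, OF e] by blast
    then show ?thesis
      unfolding eventually_at by (auto simp: dist_norm intro!: exI[of _ d])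
  qed
  have half: "1 / 2 > (0::real)" by simp
  have tri: "norm a \<le> norm b + norm c + norm d" if "a = b + c - d" for a b c d :: 'b
    unfolding that
    by (rule order_trans[OF norm_triangle_ineq4 add_right_mono[OF norm_triangle_ineq]])
  have tri2: "norm a \<le> norm b + norm c" if "a = b - c" for a b c :: 'b
    unfolding that by (rule norm_triangle_ineq4)
  have bound: "\<forall>\<^sub>F y in at x. norm (g y - g x) \<le> 2 * (K + 1) * norm (y - x)"
    using remf[OF half] remg[OF zero_less_one]
  proof eventually_elim
    case (elim y)
    have "g y - g x = Q (k' (y - x)) + (Q (f (g y)) - Q (f (g x)) - Q (k' (y - x))) - ?R (g y)"
      by simp
    then have "norm (g y - g x) \<le> norm (Q (k' (y - x))) +
        norm (Q (f (g y)) - Q (f (g x)) - Q (k' (y - x))) + norm (?R (g y))"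
      by (rule tri)
    then show ?case using elim K(2)[of "y - x"] by (simp add: algebra_simps)
  qed
  show ?thesis
    unfolding has_derivative_at_alt
  proof (intro conjI allI impI bl)
    fix e :: real assume e: "e > 0"
    \<comment> \<open>With this choice the remainder of \<open>Q \<circ> f\<close> is at most \<open>e / 2\<close> by the Lipschitz bound on \<open>g\<close>.\<close>
    define e1 where "e1 = e / (4 * (K + 1))"
    have e1: "e1 > 0" "e1 * (2 * (K + 1)) = e / 2" using e K by (auto simp: e1_def field_simps)
    have "\<forall>\<^sub>F y in at x. norm (g y - g x - Q (k' (y - x))) \<le> e * norm (y - x)"
      using remf[OF e1(1)] remg[OF half_gt_zero[OF e]] bound
    proof eventually_elim
      case (elim y)
      have "e1 * norm (g y - g x) \<le> e / 2 * norm (y - x)"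
        using mult_left_mono[OF elim(3) less_imp_le[OF e1(1)]]
        unfolding e1(2)[symmetric] by (simp only: mult.assoc)
      moreover have "g y - g x - Q (k' (y - x)) =
          (Q (f (g y)) - Q (f (g x)) - Q (k' (y - x))) - ?R (g y)" by simp
      then have "norm (g y - g x - Q (k' (y - x))) \<le>
          norm (Q (f (g y)) - Q (f (g x)) - Q (k' (y - x))) + norm (?R (g y))"
        by (rule tri2)
      ultimately show ?case using elim by (simp add: algebra_simps)
    qed
    then obtain d where "d > 0" and
      d: "\<And>y. y \<noteq> x \<Longrightarrow> dist y x < d \<Longrightarrow> norm (g y - g x - Q (k' (y - x))) \<le> e * norm (y - x)"
      unfolding eventually_at by auto
    have "norm (g y - g x - Q (k' (y - x))) \<le> e * norm (y - x)" if "norm (y - x) < d" for y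
      using d[of y] that linear_0[OF bounded_linear.linear[OF bl]] by (cases "y = x") (auto simp: dist_norm)
    then show "\<exists>d>0. \<forall>y. norm (y - x) < d \<longrightarrow> norm (g y - g x - Q (k' (y - x))) \<le> e * norm (y - x)"
      using \<open>d > 0\<close> by blast
  qed
qed

section \<open>The Minkowski product\<close>

text \<open>
  The matrix of the Minkowski product: it turns Minkowski orthogonality into Euclidean orthogonality.
\<close>

definition time_reversal :: "'n::finite minkowski \<Rightarrow> 'n minkowski" where
  "time_reversal u = (- fst u, snd u)"

lemma mink_eq_inner: "mink u v = time_reversal u \<bullet> v"
  by (simp add: mink_def time_reversal_def inner_prod_def inner_vec_def)

lemma inner_time_reversal: "time_reversal u \<bullet> v = u \<bullet> time_reversal v"
  by (simp add: time_reversal_def inner_prod_def)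

lemma mink_sym: "mink u v = mink v u"
  by (simp add: mink_def mult.commute)

lemma bounded_linear_time_reversal: "bounded_linear time_reversal"
  unfolding time_reversal_def
  by (intro bounded_linear_Pair bounded_linear_minus bounded_linear_fst bounded_linear_snd)

lemma bounded_bilinear_mink: "bounded_bilinear mink"
  unfolding mink_eq_inner
  by (rule bounded_bilinear.comp1[OF bounded_bilinear_inner bounded_linear_time_reversal])

lemmas mink_simps =
  bounded_bilinear.add_left[OF bounded_bilinear_mink]
  bounded_bilinear.add_right[OF bounded_bilinear_mink]
  bounded_bilinear.diff_left[OF bounded_bilinear_mink]
  bounded_bilinear.diff_right[OF bounded_bilinear_mink]
  bounded_bilinear.minus_left[OF bounded_bilinear_mink]
  bounded_bilinear.minus_right[OF bounded_bilinear_mink]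
  bounded_bilinear.scaleR_left[OF bounded_bilinear_mink]
  bounded_bilinear.scaleR_right[OF bounded_bilinear_mink]
  bounded_bilinear.zero_left[OF bounded_bilinear_mink]
  bounded_bilinear.zero_right[OF bounded_bilinear_mink]

lemmas mink_sum_left = bounded_bilinear.sum_left[OF bounded_bilinear_mink]
lemmas mink_sum_right = bounded_bilinear.sum_right[OF bounded_bilinear_mink]

section \<open>Parametrizations and derivatives along the submanifold\<close>

lemma local_param_open: "local_param M \<phi> V \<psi> \<Longrightarrow> open V"
  by (simp add: local_param_def)

lemma local_param_in:
  assumes "local_param M \<phi> V \<psi>" "u \<in> V"
  shows "\<psi> u \<in> M"
  using assms by (metis imageI local_param_def openin_imp_subset subsetD)

lemma local_param_smooth: "local_param M \<phi> V \<psi> \<Longrightarrow> smooth_on V (\<phi> \<circ> \<psi>)"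
  by (simp add: local_param_def)

lemma local_param_linear:
  assumes "local_param M \<phi> V \<psi>" "u \<in> V"
  shows "linear (frechet_derivative (\<phi> \<circ> \<psi>) (at u))"
  using smooth_on_has_derivative[OF local_param_smooth[OF assms(1)] assms(2)]
  by (rule has_derivative_linear)

lemma local_param_inj:
  "local_param M \<phi> V \<psi> \<Longrightarrow> u \<in> V \<Longrightarrow> inj (frechet_derivative (\<phi> \<circ> \<psi>) (at u))"
  by (simp add: local_param_def)

lemma local_param_left_inverse:
  assumes "local_param M \<phi> V \<psi>" "u \<in> V"
  obtains Q where "bounded_linear Q" "\<And>v. Q (frechet_derivative (\<phi> \<circ> \<psi>) (at u) v) = v"
proof -
  obtain Q where "linear Q" "Q \<circ> frechet_derivative (\<phi> \<circ> \<psi>) (at u) = id"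
    using linear_injective_left_inverse local_param_linear local_param_inj assms by metis
  then show ?thesis
    using that[of Q] by (auto simp: linear_conv_bounded_linear fun_eq_iff)
qed

text \<open>
  A parametrization is only required to be a homeomorphism onto an open subset of \<open>M\<close>, which makes
  the transition map \<open>\<kappa> = \<rho>\<inverse> \<circ> \<psi>\<close> continuous.  As \<open>\<phi> \<circ> \<rho>\<close> is an immersion and
  \<open>(\<phi> \<circ> \<rho>) \<circ> \<kappa> = \<phi> \<circ> \<psi>\<close> is differentiable, so is \<open>\<kappa>\<close>.
\<close>

lemma transition_map:
  assumes \<psi>: "local_param M \<phi> V \<psi>" and \<rho>: "local_param M \<phi> W \<rho>"
    and u: "u \<in> V" and w: "w \<in> W" and eq: "\<psi> u = \<rho> w"
  obtains N \<kappa> \<kappa>' where "open N" "u \<in> N" "N \<subseteq> V" "\<And>x. x \<in> N \<Longrightarrow> \<rho> (\<kappa> x) = \<psi> x" "\<kappa> u = w"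
    "(\<kappa> has_derivative \<kappa>') (at u)"
proof -
  obtain g where g: "homeomorphism W (\<rho> ` W) \<rho> g"
    using \<rho> by (auto simp: local_param_def)
  obtain g0 where g0: "homeomorphism V (\<psi> ` V) \<psi> g0"
    using \<psi> by (auto simp: local_param_def)
  define N where "N = V \<inter> \<psi> -` (\<rho> ` W)"
  have "openin (top_of_set V) N"
    unfolding N_def
  proof (rule continuous_openin_preimage)
    show "continuous_on V \<psi>" using g0 by (simp add: homeomorphism_def)
    show "\<psi> \<in> V \<rightarrow> M" using local_param_in[OF \<psi>] by auto
    show "openin (top_of_set M) (\<rho> ` W)" using \<rho> by (simp add: local_param_def)
  qed
  then have N: "open N"
    using local_param_open[OF \<psi>] by (simp add: openin_open_eq)
  have uN: "u \<in> N" using u w eq by (auto simp: N_def)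
  define \<kappa> where "\<kappa> = g \<circ> \<psi>"
  have \<kappa>: "\<rho> (\<kappa> x) = \<psi> x" if "x \<in> N" for x
    using that g by (auto simp: N_def \<kappa>_def homeomorphism_def)
  have \<kappa>u: "\<kappa> u = w"
    using g w eq by (auto simp: \<kappa>_def homeomorphism_def)
  have "continuous_on N \<kappa>"
    unfolding \<kappa>_def
  proof (rule continuous_on_compose)
    show "continuous_on N \<psi>"
      using g0 by (auto simp: N_def homeomorphism_def intro: continuous_on_subset)
    show "continuous_on (\<psi> ` N) g"
      by (rule continuous_on_subset[of "\<rho> ` W"]) (use g in \<open>auto simp: N_def homeomorphism_def\<close>)
  qed
  then have cont: "isCont \<kappa> u"
    using N uN by (simp add: continuous_on_eq_continuous_at)
  obtain Q where Q: "bounded_linear Q" "\<And>v. Q (frechet_derivative (\<phi> \<circ> \<rho>) (at w) v) = v"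
    using local_param_left_inverse[OF \<rho> w] by blast
  have "((\<lambda>y. (\<phi> \<circ> \<rho>) (\<kappa> y)) has_derivative frechet_derivative (\<phi> \<circ> \<psi>) (at u)) (at u)"
    using smooth_on_has_derivative[OF local_param_smooth[OF \<psi>] u]
    by (rule has_derivative_transform_within_open[OF _ N uN]) (simp add: \<kappa>)
  moreover have "(\<phi> \<circ> \<rho> has_derivative frechet_derivative (\<phi> \<circ> \<rho>) (at w)) (at (\<kappa> u))"
    unfolding \<kappa>u by (rule smooth_on_has_derivative[OF local_param_smooth[OF \<rho>] w])
  ultimately have "(\<kappa> has_derivative (\<lambda>v. Q (frechet_derivative (\<phi> \<circ> \<psi>) (at u) v))) (at u)"
    using has_derivative_lift_through_immersion[OF _ Q cont] by blast
  moreover have "N \<subseteq> V" by (simp add: N_def)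
  ultimately show ?thesis
    using that[of N \<kappa>] N uN \<kappa> \<kappa>u by blast
qed

text \<open>
  The coordinates \<open>k = \<kappa>' h\<close> represent in the chart \<open>\<rho>\<close> the tangent vector that has the
  coordinates \<open>h\<close> in the chart \<open>\<psi>\<close>.  Hence tangent spaces and derivatives along \<open>M\<close> can be
  computed in any single chart.
\<close>

lemma derivative_other_chart:
  assumes \<psi>: "local_param M \<phi> V \<psi>" and \<rho>: "local_param M \<phi> W \<rho>"
    and u: "u \<in> V" and w: "w \<in> W" and eq: "\<psi> u = \<rho> w"
    and Y: "(Y \<circ> \<rho> has_derivative Y') (at w)"
  obtains k where "frechet_derivative (\<phi> \<circ> \<rho>) (at w) k = frechet_derivative (\<phi> \<circ> \<psi>) (at u) h"
    and "frechet_derivative (Y \<circ> \<psi>) (at u) h = Y' k"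
proof -
  obtain N \<kappa> \<kappa>' where N: "open N" "u \<in> N" "N \<subseteq> V" and \<kappa>: "\<And>x. x \<in> N \<Longrightarrow> \<rho> (\<kappa> x) = \<psi> x" "\<kappa> u = w"
    and \<kappa>': "(\<kappa> has_derivative \<kappa>') (at u)"
    using transition_map[OF \<psi> \<rho> u w eq] by metis
  have 1: "frechet_derivative (\<phi> \<circ> \<rho>) (at w) (\<kappa>' h) = frechet_derivative (\<phi> \<circ> \<psi>) (at u) h"
  proof -
    have "((\<lambda>x. (\<phi> \<circ> \<rho>) (\<kappa> x)) has_derivative (\<lambda>h. frechet_derivative (\<phi> \<circ> \<rho>) (at w) (\<kappa>' h))) (at u)"
      by (rule has_derivative_compose[OF \<kappa>'])
        (simp only: \<kappa>(2) smooth_on_has_derivative[OF local_param_smooth[OF \<rho>] w])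
    then have "(\<phi> \<circ> \<psi> has_derivative (\<lambda>h. frechet_derivative (\<phi> \<circ> \<rho>) (at w) (\<kappa>' h))) (at u)"
      by (rule has_derivative_transform_within_open[OF _ N(1,2)]) (simp add: \<kappa>)
    then show ?thesis by (simp add: frechet_derivative_eq)
  qed
  have 2: "frechet_derivative (Y \<circ> \<psi>) (at u) h = Y' (\<kappa>' h)"
  proof -
    have "((\<lambda>x. (Y \<circ> \<rho>) (\<kappa> x)) has_derivative (\<lambda>h. Y' (\<kappa>' h))) (at u)"
      by (rule has_derivative_compose[OF \<kappa>']) (simp only: \<kappa>(2) Y)
    then have "(Y \<circ> \<psi> has_derivative (\<lambda>h. Y' (\<kappa>' h))) (at u)"
      by (rule has_derivative_transform_within_open[OF _ N(1,2)]) (simp add: \<kappa>)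
    then show ?thesis by (simp add: frechet_derivative_eq)
  qed
  show ?thesis by (rule that[OF 1 2])
qed

lemma tangent_space_chart:
  assumes \<psi>: "local_param M \<phi> V \<psi>" and u: "u \<in> V"
  shows "tangent_space M \<phi> (\<psi> u) = range (frechet_derivative (\<phi> \<circ> \<psi>) (at u))"
proof
  show "range (frechet_derivative (\<phi> \<circ> \<psi>) (at u)) \<subseteq> tangent_space M \<phi> (\<psi> u)"
    unfolding tangent_space_def using \<psi> u by blast
  show "tangent_space M \<phi> (\<psi> u) \<subseteq> range (frechet_derivative (\<phi> \<circ> \<psi>) (at u))"
  proof
    fix x assume "x \<in> tangent_space M \<phi> (\<psi> u)"
    then obtain W \<rho> w h where \<rho>: "local_param M \<phi> W \<rho>" "w \<in> W" "\<rho> w = \<psi> u"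
      and x: "x = frechet_derivative (\<phi> \<circ> \<rho>) (at w) h"
      unfolding tangent_space_def by blast
    then show "x \<in> range (frechet_derivative (\<phi> \<circ> \<psi>) (at u))"
      using derivative_other_chart[OF \<rho>(1) \<psi> \<rho>(2) u \<rho>(3)
          smooth_on_has_derivative[OF local_param_smooth[OF \<psi>] u], of h] by (metis rangeI)
  qed
qed

lemma deriv_along_chart:
  assumes \<psi>: "local_param M \<phi> V \<psi>" and u: "u \<in> V" and Y: "(Y \<circ> \<psi> has_derivative Y') (at u)"
  shows "deriv_along M \<phi> (\<psi> u) (frechet_derivative (\<phi> \<circ> \<psi>) (at u) h) Y = Y' h"
  unfolding deriv_along_def
proof (rule the_equality)
  show "\<exists>W \<rho> w k. local_param M \<phi> W \<rho> \<and> w \<in> W \<and> \<rho> w = \<psi> u \<and>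
      frechet_derivative (\<phi> \<circ> \<rho>) (at w) k = frechet_derivative (\<phi> \<circ> \<psi>) (at u) h \<and>
      Y' h = frechet_derivative (Y \<circ> \<rho>) (at w) k"
    using \<psi> u frechet_derivative_eq[OF Y] by metis
next
  fix d
  assume "\<exists>W \<rho> w k. local_param M \<phi> W \<rho> \<and> w \<in> W \<and> \<rho> w = \<psi> u \<and>
      frechet_derivative (\<phi> \<circ> \<rho>) (at w) k = frechet_derivative (\<phi> \<circ> \<psi>) (at u) h \<and>
      d = frechet_derivative (Y \<circ> \<rho>) (at w) k"
  then obtain W \<rho> w k where \<rho>: "local_param M \<phi> W \<rho>" "w \<in> W" "\<rho> w = \<psi> u"
    and k: "frechet_derivative (\<phi> \<circ> \<rho>) (at w) k = frechet_derivative (\<phi> \<circ> \<psi>) (at u) h"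
    and d: "d = frechet_derivative (Y \<circ> \<rho>) (at w) k" by blast
  obtain h' where h': "frechet_derivative (\<phi> \<circ> \<psi>) (at u) h' = frechet_derivative (\<phi> \<circ> \<rho>) (at w) k"
    "frechet_derivative (Y \<circ> \<rho>) (at w) k = Y' h'"
    by (rule derivative_other_chart[OF \<rho>(1) \<psi> \<rho>(2) u \<rho>(3) Y])
  have "h' = h"
    using h'(1) k local_param_inj[OF \<psi> u] by (simp add: inj_eq)
  then show "d = Y' h" using d h' by simp
qed

lemma tangent_vector_chart:
  assumes "x \<in> tangent_space M \<phi> p"
  obtains V \<psi> u h where "local_param M \<phi> V \<psi>" "u \<in> V" "p = \<psi> u"
    "x = frechet_derivative (\<phi> \<circ> \<psi>) (at u) h"
  using assms unfolding tangent_space_def by blast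

lemma smooth_map_has_derivative:
  assumes "smooth_map M \<phi> Y" "local_param M \<phi> V \<psi>" "u \<in> V"
  shows "(Y \<circ> \<psi> has_derivative frechet_derivative (Y \<circ> \<psi>) (at u)) (at u)"
  using assms smooth_on_has_derivative unfolding smooth_map_def by blast

lemma smooth_map_cong:
  assumes "\<And>q. q \<in> M \<Longrightarrow> Y q = Z q" "smooth_map M \<phi> Y"
  shows "smooth_map M \<phi> Z"
  unfolding smooth_map_def
proof (intro allI impI)
  fix V \<psi> assume \<psi>: "local_param M \<phi> V \<psi>"
  show "smooth_on V (Z \<circ> \<psi>)"
  proof (rule smooth_on_cong[OF local_param_open[OF \<psi>]])
    show "smooth_on V (Y \<circ> \<psi>)" using assms(2) \<psi> by (simp add: smooth_map_def)
    show "(Y \<circ> \<psi>) u = (Z \<circ> \<psi>) u" if "u \<in> V" for u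
      using assms(1) local_param_in[OF \<psi> that] by simp
  qed
qed

lemma smooth_map_position: "smooth_map M \<phi> \<phi>"
  by (simp add: smooth_map_def local_param_smooth)

lemma smooth_map_const: "smooth_map M \<phi> (\<lambda>q. c)"
  by (simp add: smooth_map_def comp_def smooth_on_const local_param_open)

lemma smooth_map_add:
  "smooth_map M \<phi> Y \<Longrightarrow> smooth_map M \<phi> Z \<Longrightarrow> smooth_map M \<phi> (\<lambda>q. Y q + Z q)"
  by (simp add: smooth_map_def comp_def smooth_on_add local_param_open)

lemma smooth_map_sum:
  "(\<And>i. i \<in> I \<Longrightarrow> smooth_map M \<phi> (Y i)) \<Longrightarrow> smooth_map M \<phi> (\<lambda>q. \<Sum>i\<in>I. Y i q)"
  by (simp add: smooth_map_def comp_def smooth_on_sum local_param_open)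

lemma smooth_map_bounded_linear:
  "bounded_linear L \<Longrightarrow> smooth_map M \<phi> Y \<Longrightarrow> smooth_map M \<phi> (\<lambda>q. L (Y q))"
  unfolding smooth_map_def comp_def
  using smooth_on_bounded_linear[of _ L] local_param_open by blast

lemma smooth_map_bounded_bilinear:
  "bounded_bilinear B \<Longrightarrow> smooth_map M \<phi> Y \<Longrightarrow> smooth_map M \<phi> Z \<Longrightarrow>
    smooth_map M \<phi> (\<lambda>q. B (Y q) (Z q))"
  unfolding smooth_map_def comp_def
  using smooth_on_bounded_bilinear[of _ B] local_param_open by blast

lemmas smooth_map_scaleR = smooth_map_bounded_bilinear[OF bounded_bilinear_scaleR]
lemmas smooth_map_mink = smooth_map_bounded_bilinear[OF bounded_bilinear_mink]
lemmas smooth_map_mult = smooth_map_bounded_bilinear[OF bounded_bilinear_mult[where ?'a = real]]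

lemma deriv_along_cong:
  assumes x: "x \<in> tangent_space M \<phi> p" and Y: "smooth_map M \<phi> Y" and eq: "\<And>q. q \<in> M \<Longrightarrow> Y q = Z q"
  shows "deriv_along M \<phi> p x Z = deriv_along M \<phi> p x Y"
proof -
  obtain V \<psi> u h where \<psi>: "local_param M \<phi> V \<psi>" "u \<in> V" "p = \<psi> u"
    "x = frechet_derivative (\<phi> \<circ> \<psi>) (at u) h"
    using tangent_vector_chart[OF x] .
  have "(Z \<circ> \<psi> has_derivative frechet_derivative (Y \<circ> \<psi>) (at u)) (at u)"
    using smooth_map_has_derivative[OF Y \<psi>(1,2)]
    by (rule has_derivative_transform_within_open[OF _ local_param_open[OF \<psi>(1)] \<psi>(2)])
      (simp add: eq local_param_in[OF \<psi>(1)])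
  then show ?thesis
    unfolding \<psi>(3,4) using deriv_along_chart[OF \<psi>(1,2)] smooth_map_has_derivative[OF Y \<psi>(1,2)]
    by metis
qed

lemma deriv_along_position:
  assumes x: "x \<in> tangent_space M \<phi> p"
  shows "deriv_along M \<phi> p x \<phi> = x"
proof -
  obtain V \<psi> u h where \<psi>: "local_param M \<phi> V \<psi>" "u \<in> V" "p = \<psi> u"
    "x = frechet_derivative (\<phi> \<circ> \<psi>) (at u) h"
    using tangent_vector_chart[OF x] .
  then show ?thesis
    using deriv_along_chart[OF \<psi>(1,2) smooth_map_has_derivative[OF smooth_map_position \<psi>(1,2)]] by simp
qed

lemma deriv_along_const:
  assumes x: "x \<in> tangent_space M \<phi> p"
  shows "deriv_along M \<phi> p x (\<lambda>q. c) = 0"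
proof -
  obtain V \<psi> u h where \<psi>: "local_param M \<phi> V \<psi>" "u \<in> V" "p = \<psi> u"
    "x = frechet_derivative (\<phi> \<circ> \<psi>) (at u) h"
    using tangent_vector_chart[OF x] .
  have "((\<lambda>q. c) \<circ> \<psi> has_derivative (\<lambda>h. 0)) (at u)" by (simp add: comp_def)
  then show ?thesis
    unfolding \<psi>(3,4) by (rule deriv_along_chart[OF \<psi>(1,2)])
qed

lemma deriv_along_add:
  assumes x: "x \<in> tangent_space M \<phi> p" and Y: "smooth_map M \<phi> Y" and Z: "smooth_map M \<phi> Z"
  shows "deriv_along M \<phi> p x (\<lambda>q. Y q + Z q) = deriv_along M \<phi> p x Y + deriv_along M \<phi> p x Z"
proof -
  obtain V \<psi> u h where \<psi>: "local_param M \<phi> V \<psi>" "u \<in> V" "p = \<psi> u"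
    "x = frechet_derivative (\<phi> \<circ> \<psi>) (at u) h"
    using tangent_vector_chart[OF x] .
  note Yd = smooth_map_has_derivative[OF Y \<psi>(1,2)] and Zd = smooth_map_has_derivative[OF Z \<psi>(1,2)]
  have "((\<lambda>q. Y q + Z q) \<circ> \<psi> has_derivative
      (\<lambda>h. frechet_derivative (Y \<circ> \<psi>) (at u) h + frechet_derivative (Z \<circ> \<psi>) (at u) h)) (at u)"
    using has_derivative_add[OF Yd Zd] by (simp add: comp_def)
  from deriv_along_chart[OF \<psi>(1,2) this] show ?thesis
    unfolding \<psi>(3,4) by (simp add: deriv_along_chart[OF \<psi>(1,2) Yd] deriv_along_chart[OF \<psi>(1,2) Zd])
qed

lemma deriv_along_bounded_linear:
  assumes x: "x \<in> tangent_space M \<phi> p" and L: "bounded_linear L" and Y: "smooth_map M \<phi> Y"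
  shows "deriv_along M \<phi> p x (\<lambda>q. L (Y q)) = L (deriv_along M \<phi> p x Y)"
proof -
  obtain V \<psi> u h where \<psi>: "local_param M \<phi> V \<psi>" "u \<in> V" "p = \<psi> u"
    "x = frechet_derivative (\<phi> \<circ> \<psi>) (at u) h"
    using tangent_vector_chart[OF x] .
  note Yd = smooth_map_has_derivative[OF Y \<psi>(1,2)]
  have "((\<lambda>q. L (Y q)) \<circ> \<psi> has_derivative (\<lambda>h. L (frechet_derivative (Y \<circ> \<psi>) (at u) h))) (at u)"
    using bounded_linear.has_derivative[OF L Yd] by (simp add: comp_def)
  from deriv_along_chart[OF \<psi>(1,2) this] show ?thesis
    unfolding \<psi>(3,4) by (simp add: deriv_along_chart[OF \<psi>(1,2) Yd])
qed

lemma deriv_along_bounded_bilinear: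
  assumes x: "x \<in> tangent_space M \<phi> p" and B: "bounded_bilinear B"
    and Y: "smooth_map M \<phi> Y" and Z: "smooth_map M \<phi> Z"
  shows "deriv_along M \<phi> p x (\<lambda>q. B (Y q) (Z q)) =
    B (Y p) (deriv_along M \<phi> p x Z) + B (deriv_along M \<phi> p x Y) (Z p)"
proof -
  obtain V \<psi> u h where \<psi>: "local_param M \<phi> V \<psi>" "u \<in> V" "p = \<psi> u"
    "x = frechet_derivative (\<phi> \<circ> \<psi>) (at u) h"
    using tangent_vector_chart[OF x] .
  note Yd = smooth_map_has_derivative[OF Y \<psi>(1,2)] and Zd = smooth_map_has_derivative[OF Z \<psi>(1,2)]
  have "((\<lambda>q. B (Y q) (Z q)) \<circ> \<psi> has_derivative
      (\<lambda>h. B (Y (\<psi> u)) (frechet_derivative (Z \<circ> \<psi>) (at u) h) +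
           B (frechet_derivative (Y \<circ> \<psi>) (at u) h) (Z (\<psi> u)))) (at u)"
    using bounded_bilinear.FDERIV[OF B Yd Zd] by (simp add: comp_def)
  from deriv_along_chart[OF \<psi>(1,2) this] show ?thesis
    unfolding \<psi>(3,4) by (simp add: deriv_along_chart[OF \<psi>(1,2) Yd] deriv_along_chart[OF \<psi>(1,2) Zd])
qed

lemmas deriv_along_mink = deriv_along_bounded_bilinear[OF _ bounded_bilinear_mink]
lemmas deriv_along_scaleR = deriv_along_bounded_bilinear[OF _ bounded_bilinear_scaleR]

lemma chart_at:
  assumes "immersed_submanifold M \<phi>" "p \<in> M"
  obtains V \<psi> u where "local_param M \<phi> V \<psi>" "u \<in> V" "p = \<psi> u"
  using assms unfolding immersed_submanifold_def by blast

lemma subspace_tangent_space: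
  assumes "immersed_submanifold M \<phi>" "p \<in> M"
  shows "subspace (tangent_space M \<phi> p)"
proof -
  obtain V \<psi> u where \<psi>: "local_param M \<phi> V \<psi>" "u \<in> V" "p = \<psi> u" using chart_at[OF assms] .
  show ?thesis
    unfolding \<psi>(3) tangent_space_chart[OF \<psi>(1,2)]
    by (rule linear_subspace_image[OF local_param_linear[OF \<psi>(1,2)] subspace_UNIV])
qed

lemma dim_tangent_space:
  fixes \<phi> :: "'p::topological_space \<Rightarrow> 'n::finite minkowski"
  assumes "immersed_submanifold M \<phi>" "p \<in> M"
  shows "dim (tangent_space M \<phi> p) = CARD('n)"
proof -
  obtain V \<psi> u where \<psi>: "local_param M \<phi> V \<psi>" "u \<in> V" "p = \<psi> u" using chart_at[OF assms] .
  have "dim (range (frechet_derivative (\<phi> \<circ> \<psi>) (at u))) = dim (UNIV :: (real ^ 'n) set)"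
    using local_param_linear[OF \<psi>(1,2)] local_param_inj[OF \<psi>(1,2)]
    by (intro dim_image_eq) auto
  then show ?thesis
    unfolding \<psi>(3) tangent_space_chart[OF \<psi>(1,2)] by simp
qed

text \<open>
  The derivative is meaningful on tangent vectors only; composing with a left inverse of the
  differential of a chart extends it to a linear map on the ambient space, so that statements about
  linear and bilinear maps apply to it.
\<close>

lemma deriv_along_linear_direction:
  assumes "immersed_submanifold M \<phi>" "p \<in> M" "smooth_map M \<phi> Y"
  obtains D where "linear D" "\<And>x. x \<in> tangent_space M \<phi> p \<Longrightarrow> deriv_along M \<phi> p x Y = D x"
proof -
  obtain V \<psi> u where \<psi>: "local_param M \<phi> V \<psi>" "u \<in> V" "p = \<psi> u" using chart_at[OF assms(1,2)] .
  obtain Q where Q: "bounded_linear Q" "\<And>v. Q (frechet_derivative (\<phi> \<circ> \<psi>) (at u) v) = v"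
    using local_param_left_inverse[OF \<psi>(1,2)] by blast
  note Yd = smooth_map_has_derivative[OF assms(3) \<psi>(1,2)]
  show ?thesis
  proof (rule that)
    show "linear (frechet_derivative (Y \<circ> \<psi>) (at u) \<circ> Q)"
      by (rule linear_compose[OF bounded_linear.linear[OF Q(1)] has_derivative_linear[OF Yd]])
    show "deriv_along M \<phi> p x Y = (frechet_derivative (Y \<circ> \<psi>) (at u) \<circ> Q) x"
      if "x \<in> tangent_space M \<phi> p" for x
      using that deriv_along_chart[OF \<psi>(1,2) Yd] Q(2)
      unfolding \<psi>(3) tangent_space_chart[OF \<psi>(1,2)] by auto
  qed
qed

text \<open>
  Differentiating \<open>\<langle>\<zeta>, dF k\<rangle> = 0\<close> in the direction \<open>h\<close>, where \<open>F\<close> is a parametrization, expresses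
  \<open>\<langle>D\<^sub>h \<zeta>, dF k\<rangle>\<close> by the second derivative of \<open>F\<close>, which is symmetric.
\<close>

lemma normal_field_derivative_symmetric:
  assumes imm: "immersed_submanifold M \<phi>" and p: "p \<in> M" and \<zeta>: "normal_field M \<phi> \<zeta>"
    and x: "x \<in> tangent_space M \<phi> p" and y: "y \<in> tangent_space M \<phi> p"
  shows "mink (deriv_along M \<phi> p x \<zeta>) y = mink (deriv_along M \<phi> p y \<zeta>) x"
proof -
  obtain V \<psi> u where \<psi>: "local_param M \<phi> V \<psi>" "u \<in> V" "p = \<psi> u" using chart_at[OF imm p] .
  let ?F = "\<phi> \<circ> \<psi>"
  let ?D = "\<lambda>x. frechet_derivative ?F (at x)"
  obtain h k where hk: "x = ?D u h" "y = ?D u k"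
    using x y unfolding \<psi>(3) tangent_space_chart[OF \<psi>(1,2)] by blast
  note V = local_param_open[OF \<psi>(1)] and F = local_param_smooth[OF \<psi>(1)]
  have smooth_\<zeta>: "smooth_map M \<phi> \<zeta>" using \<zeta> by (simp add: normal_field_def)
  note \<zeta>d = smooth_map_has_derivative[OF smooth_\<zeta> \<psi>(1,2)]
  let ?H = "\<lambda>a b. frechet_derivative (\<lambda>x. ?D x a) (at u) b"
  have key: "mink (frechet_derivative (\<zeta> \<circ> \<psi>) (at u) b) (?D u a) = - mink (\<zeta> p) (?H a b)" for a b
  proof -
    have "((\<lambda>x. mink ((\<zeta> \<circ> \<psi>) x) (?D x a)) has_derivative
        (\<lambda>b. mink ((\<zeta> \<circ> \<psi>) u) (?H a b) + mink (frechet_derivative (\<zeta> \<circ> \<psi>) (at u) b) (?D u a))) (at u)"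
      by (rule bounded_bilinear.FDERIV[OF bounded_bilinear_mink \<zeta>d
            smooth_on_has_derivative[OF smooth_on_derivative[OF F] \<psi>(2)]])
    moreover have "((\<lambda>x. mink ((\<zeta> \<circ> \<psi>) x) (?D x a)) has_derivative (\<lambda>b. 0)) (at u)"
    proof (rule has_derivative_transform_within_open[OF _ V \<psi>(2)])
      show "0 = mink ((\<zeta> \<circ> \<psi>) v) (?D v a)" if "v \<in> V" for v
        using \<zeta> local_param_in[OF \<psi>(1) that] tangent_space_chart[OF \<psi>(1) that]
        by (simp add: normal_field_def)
    qed simp
    ultimately have "(\<lambda>b. mink ((\<zeta> \<circ> \<psi>) u) (?H a b) +
        mink (frechet_derivative (\<zeta> \<circ> \<psi>) (at u) b) (?D u a)) = (\<lambda>b. 0)"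
      by (rule has_derivative_unique)
    then show ?thesis
      by (simp add: fun_eq_iff \<psi>(3) add_eq_0_iff2)
  qed
  have sym: "mink c (?H a b) = mink c (?H b a)" for a b c
  proof -
    let ?f = "\<lambda>x. mink c (?F x)"
    have bl: "bounded_linear (mink c)"
      by (rule bounded_bilinear.bounded_linear_right[OF bounded_bilinear_mink])
    have f: "smooth_on V ?f"
      by (rule smooth_on_bounded_linear[OF V bl F])
    have 1: "frechet_derivative ?f (at v) a = mink c (?D v a)" if "v \<in> V" for v a
      using frechet_derivative_eq[OF bounded_linear.has_derivative[OF bl smooth_on_has_derivative[OF F that]]]
      by simp
    have 2: "frechet_derivative (\<lambda>x. frechet_derivative ?f (at x) a) (at u) b = mink c (?H a b)" for a b
      using frechet_derivative_cong_open[OF V \<psi>(2), of "\<lambda>x. frechet_derivative ?f (at x) a", OF 1]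
        frechet_derivative_eq[OF bounded_linear.has_derivative[OF bl
            smooth_on_has_derivative[OF smooth_on_derivative[OF F] \<psi>(2)]], of a]
      by simp
    show ?thesis
      using smooth_on_second_derivative_symmetric[OF V f \<psi>(2), of a b] unfolding 2 .
  qed
  show ?thesis
    unfolding hk \<psi>(3) using deriv_along_chart[OF \<psi>(1,2) \<zeta>d] key[of h k] key[of k h] sym[of _ h k]
    by simp
qed

lemma linear_eq_sum_axis:
  fixes f :: "real ^ 'n::finite \<Rightarrow> 'b::real_vector"
  assumes "linear f"
  shows "f x = (\<Sum>k\<in>UNIV. x $ k *\<^sub>R f (axis k 1))"
proof -
  have "f x = f (\<Sum>k\<in>UNIV. x $ k *\<^sub>R axis k 1)"
    using basis_expansion[of x] by (simp add: scalar_mult_eq_scaleR)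
  then show ?thesis
    using assms by (simp add: linear_sum linear_scale)
qed

text \<open>
  In a parametrization the components of \<open>W\<close> solve a linear system whose matrix is the first
  fundamental form, which is regular as the metric is Riemannian.
\<close>

lemma smooth_map_deriv_along_field:
  assumes riem: "riemannian_submanifold M \<phi>" and W: "tangent_field M \<phi> W" and Y: "smooth_map M \<phi> Y"
  shows "smooth_map M \<phi> (\<lambda>q. deriv_along M \<phi> q (W q) Y)"
  unfolding smooth_map_def
proof (intro allI impI)
  fix V \<psi> assume \<psi>: "local_param M \<phi> V \<psi>"
  note V = local_param_open[OF \<psi>] and F = local_param_smooth[OF \<psi>]
  let ?D = "\<lambda>u. frechet_derivative (\<phi> \<circ> \<psi>) (at u)"
  define x where "x u = (SOME h. ?D u h = W (\<psi> u))" for u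
  have x: "?D u (x u) = W (\<psi> u)" if "u \<in> V" for u
  proof -
    have "\<exists>h. ?D u h = W (\<psi> u)"
      using W local_param_in[OF \<psi> that] tangent_space_chart[OF \<psi> that]
      unfolding tangent_field_def by (metis rangeE)
    then show ?thesis unfolding x_def by (rule someI_ex)
  qed
  define G where "G u = (\<chi> i j. mink (?D u (axis i 1)) (?D u (axis j 1)))" for u
  define b where "b u = (\<chi> i. mink (?D u (axis i 1)) (W (\<psi> u)))" for u
  have Gv: "(G u *v v) $ i = mink (?D u (axis i 1)) (?D u v)" if "u \<in> V" for u v i
    unfolding linear_eq_sum_axis[OF local_param_linear[OF \<psi> that], of v]
    by (simp add: G_def matrix_vector_mult_def mink_sum_right mink_simps mult.commute)
  have det: "det (G u) \<noteq> 0" if u: "u \<in> V" for u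
  proof -
    have "v = 0" if v: "G u *v v = 0" for v
    proof -
      have "mink (?D u v) (?D u v) = (\<Sum>i\<in>UNIV. v $ i * mink (?D u (axis i 1)) (?D u v))"
        by (subst (1) linear_eq_sum_axis[OF local_param_linear[OF \<psi> u], of v])
          (simp add: mink_sum_left mink_simps)
      also have "\<dots> = 0"
        using v by (simp flip: Gv[OF u])
      finally have "?D u v = 0"
        using riem local_param_in[OF \<psi> u] tangent_space_chart[OF \<psi> u]
        unfolding riemannian_submanifold_def by (metis less_irrefl rangeI)
      then show "v = 0"
        using local_param_inj[OF \<psi> u] linear_0[OF local_param_linear[OF \<psi> u]] by (metis injD)
    qed
    then show ?thesis
      using matrix_left_invertible_ker[of "G u"] by (metis invertible_det_nz invertible_left_inverse)
  qed
  have smooth_G: "smooth_on V (\<lambda>u. G u $ i $ j)" for i j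
    unfolding G_def
    by (simp add: smooth_on_bounded_bilinear[OF V bounded_bilinear_mink] smooth_on_derivative F)
  have W\<psi>: "smooth_on V (W \<circ> \<psi>)" using W \<psi> by (simp add: tangent_field_def smooth_map_def)
  have smooth_b: "smooth_on V (\<lambda>u. b u $ i)" for i
    using smooth_on_bounded_bilinear[OF V bounded_bilinear_mink smooth_on_derivative[OF F] W\<psi>]
    by (simp add: b_def)
  have "G u *v x u = b u" if "u \<in> V" for u
    using Gv[OF that] x[OF that] by (simp add: vec_eq_iff b_def)
  from smooth_on_linear_system_solution[OF V smooth_G smooth_b det this]
  have smooth_x: "smooth_on V (\<lambda>u. x u $ k)" for k .
  show "smooth_on V ((\<lambda>q. deriv_along M \<phi> q (W q) Y) \<circ> \<psi>)"
  proof (rule smooth_on_cong[OF V])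
    show "smooth_on V (\<lambda>u. \<Sum>k\<in>UNIV. x u $ k *\<^sub>R frechet_derivative (Y \<circ> \<psi>) (at u) (axis k 1))"
      using Y \<psi> by (intro smooth_on_sum smooth_on_bounded_bilinear[OF V bounded_bilinear_scaleR]
          V smooth_x smooth_on_derivative) (simp add: smooth_map_def)
    fix u assume u: "u \<in> V"
    note Yd = smooth_map_has_derivative[OF Y \<psi> u]
    have "deriv_along M \<phi> (\<psi> u) (W (\<psi> u)) Y = frechet_derivative (Y \<circ> \<psi>) (at u) (x u)"
      using deriv_along_chart[OF \<psi> u Yd, of "x u"] x[OF u] by simp
    then show "(\<Sum>k\<in>UNIV. x u $ k *\<^sub>R frechet_derivative (Y \<circ> \<psi>) (at u) (axis k 1)) =
        ((\<lambda>q. deriv_along M \<phi> q (W q) Y) \<circ> \<psi>) u"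
      using linear_eq_sum_axis[OF has_derivative_linear[OF Yd], of "x u"] by simp
  qed
qed

section \<open>Orthogonal projections and traces for the Minkowski product\<close>

lemma mink_orth_proj_eqI:
  assumes V: "subspace V" and definite: "\<And>x. x \<in> V \<Longrightarrow> mink x x = 0 \<Longrightarrow> x = 0"
    and w: "w \<in> V" and orth: "\<And>x. x \<in> V \<Longrightarrow> mink (v - w) x = 0"
  shows "mink_orth_proj V v = w"
  unfolding mink_orth_proj_def
proof (rule the_equality)
  show "w \<in> V \<and> (\<forall>x\<in>V. mink (v - w) x = 0)" using w orth by blast
  fix w' assume w': "w' \<in> V \<and> (\<forall>x\<in>V. mink (v - w') x = 0)"
  then have "w - w' \<in> V" using w V by (simp add: subspace_diff)
  then have "mink (v - w') (w - w') = 0" "mink (v - w) (w - w') = 0" using w' orth by auto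
  then have "mink (w - w') (w - w') = 0" by (simp add: mink_simps)
  then show "w' = w" using definite[OF \<open>w - w' \<in> V\<close>] by simp
qed

lemma mink_orthonormal_expansion:
  assumes b: "mink_orthonormal_basis V I b" and I: "finite I" and x: "x \<in> V"
  shows "x = (\<Sum>i\<in>I. mink x (b i) *\<^sub>R b i)"
proof -
  define g where "g x = (\<Sum>i\<in>I. mink x (b i) *\<^sub>R b i)" for x
  have g: "linear g"
    unfolding g_def
    by (rule linearI) (simp_all add: mink_simps scaleR_add_left sum.distrib scaleR_sum_right)
  have "x \<in> span (b ` I)" using b x by (simp add: mink_orthonormal_basis_def)
  then have "g x = x"
  proof (induction rule: span_induct)
    case base
    show ?case
      by (simp add: subspace_def linear_0[OF g] linear_add[OF g] linear_scale[OF g])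
  next
    case (step x)
    then obtain j where j: "j \<in> I" "x = b j" by blast
    have "g (b j) = (\<Sum>i\<in>I. if j = i then b i else 0)"
      unfolding g_def using b j(1) by (intro sum.cong) (auto simp: mink_orthonormal_basis_def)
    then show ?case using I j by (simp add: sum.delta)
  qed
  then show ?thesis by (simp add: g_def)
qed

lemma mink_orthonormal_basis_insert:
  assumes V: "subspace V" and u: "u \<in> V" "mink u u = 1" and I: "finite I" "k \<notin> I" and bk: "b k = u"
    and b: "mink_orthonormal_basis {x \<in> V. mink x u = 0} I b"
  shows "mink_orthonormal_basis V (insert k I) b"
  unfolding mink_orthonormal_basis_def
proof (intro conjI)
  have bI: "b i \<in> V" "mink (b i) u = 0" if "i \<in> I" for i
    using b that by (auto simp: mink_orthonormal_basis_def)
  then show "\<forall>i\<in>insert k I. b i \<in> V" using bk u by auto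
  show "\<forall>i\<in>insert k I. \<forall>j\<in>insert k I. mink (b i) (b j) = (if i = j then 1 else 0)"
    using b bI(2) bk u I(2) by (auto simp: mink_orthonormal_basis_def mink_sym[of u "b i" for i])
  show "span (b ` insert k I) = V"
  proof
    show "span (b ` insert k I) \<subseteq> V"
      using bI bk u V by (intro span_minimal) auto
    show "V \<subseteq> span (b ` insert k I)"
    proof
      fix x assume x: "x \<in> V"
      have "x - mink x u *\<^sub>R u \<in> {x \<in> V. mink x u = 0}"
        using x u V by (simp add: subspace_diff subspace_scale mink_simps)
      then have "x - mink x u *\<^sub>R u \<in> span (b ` I)"
        using b by (simp add: mink_orthonormal_basis_def)
      then have "x - mink x u *\<^sub>R u \<in> span (b ` insert k I)"
        by (meson span_mono image_mono subset_insertI subsetD)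
      moreover have "mink x u *\<^sub>R u \<in> span (b ` insert k I)"
        using bk by (intro span_scale span_base) auto
      ultimately show "x \<in> span (b ` insert k I)"
        using span_add[of "x - mink x u *\<^sub>R u" _ "mink x u *\<^sub>R u"] by simp
    qed
  qed
qed

text \<open>
  The right-hand side does not mention \<open>b\<close>: it shows that traces are independent of the
  orthonormal basis, and that they depend smoothly on the base point if the projection \<open>P\<close> does.
  The vectors \<open>time_reversal E\<close> form the basis dual to \<open>Basis\<close> for the Minkowski product.
\<close>

lemma mink_trace_eq_ambient_trace:
  fixes f :: "'n::finite minkowski \<Rightarrow> 'n minkowski \<Rightarrow> real"
  assumes f: "bilinear f" and b: "mink_orthonormal_basis V I b" and I: "finite I"
    and P: "\<And>v. P v \<in> V" "\<And>v x. x \<in> V \<Longrightarrow> mink (P v) x = mink v x"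
  shows "(\<Sum>i\<in>I. f (b i) (b i)) = (\<Sum>E\<in>Basis. f (P (time_reversal E)) (P E))"
proof -
  have bV: "b i \<in> V" if "i \<in> I" for i using b that by (simp add: mink_orthonormal_basis_def)
  have Pb: "P v = (\<Sum>i\<in>I. mink v (b i) *\<^sub>R b i)" for v
    using mink_orthonormal_expansion[OF b I P(1), of v] P(2)[OF bV] by (metis (no_types, lifting) sum.cong)
  have rev: "mink (time_reversal E) v = E \<bullet> v" for E v :: "'n minkowski"
    by (simp add: mink_eq_inner) (simp add: time_reversal_def)
  have lin: "f (\<Sum>i\<in>I. c i *\<^sub>R b i) (\<Sum>k\<in>I. d k *\<^sub>R b k) = (\<Sum>i\<in>I. \<Sum>k\<in>I. c i * d k * f (b i) (b k))"
    for c d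
    by (simp add: bilinear_sum[OF f] sum.cartesian_product bilinear_lmul[OF f] bilinear_rmul[OF f]
        mult.assoc mult.left_commute)
  have "(\<Sum>E\<in>Basis. f (P (time_reversal E)) (P E)) =
      (\<Sum>E\<in>Basis. \<Sum>i\<in>I. \<Sum>k\<in>I. (E \<bullet> b i) * mink E (b k) * f (b i) (b k))"
    by (simp only: Pb lin rev)
  also have "\<dots> = (\<Sum>i\<in>I. \<Sum>E\<in>Basis. \<Sum>k\<in>I. (E \<bullet> b i) * mink E (b k) * f (b i) (b k))"
    by (rule sum.swap)
  also have "\<dots> = (\<Sum>i\<in>I. \<Sum>k\<in>I. \<Sum>E\<in>Basis. (E \<bullet> b i) * mink E (b k) * f (b i) (b k))"
    by (intro sum.cong refl sum.swap)
  also have "\<dots> = (\<Sum>i\<in>I. \<Sum>k\<in>I. mink (b k) (b i) * f (b i) (b k))"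
  proof (intro sum.cong refl)
    fix i k
    have "(\<Sum>E\<in>Basis. (E \<bullet> b i) * mink E (b k)) = mink (b k) (b i)"
      unfolding mink_eq_inner euclidean_inner[of "time_reversal (b k)" "b i"]
      by (intro sum.cong refl) (metis inner_time_reversal inner_commute mult.commute)
    then show "(\<Sum>E\<in>Basis. (E \<bullet> b i) * mink E (b k) * f (b i) (b k)) = mink (b k) (b i) * f (b i) (b k)"
      by (simp flip: sum_distrib_right)
  qed
  also have "\<dots> = (\<Sum>i\<in>I. \<Sum>k\<in>I. if k = i then f (b i) (b k) else 0)"
    using b by (intro sum.cong refl) (auto simp: mink_orthonormal_basis_def)
  also have "\<dots> = (\<Sum>i\<in>I. f (b i) (b i))"
    using I by simp
  finally show ?thesis ..
qed

section \<open>Submanifolds of the light cone cylinder\<close>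

locale light_cone_submanifold =
  fixes M :: "'p::topological_space set" and \<phi> :: "'p \<Rightarrow> 'n::finite minkowski"
    and \<xi> :: "'p \<Rightarrow> 'n minkowski"
  assumes riem: "riemannian_submanifold M \<phi>"
    and on_cone: "\<phi> ` M \<subseteq> light_cone_cylinder"
    and xi_field: "normal_field M \<phi> \<xi>"
    and xi_null: "\<And>p. p \<in> M \<Longrightarrow> mink (\<xi> p) (\<xi> p) = 0"
    and xi_theta: "\<And>p. p \<in> M \<Longrightarrow> mink (\<xi> p) (theta_field \<phi> p) = - 1"
begin

abbreviation T where "T \<equiv> tangent_space M \<phi>"
abbreviation D where "D \<equiv> deriv_along M \<phi>"
abbreviation \<theta> where "\<theta> \<equiv> theta_field \<phi>"
abbreviation P where "P \<equiv> tangential_part M \<phi>"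
abbreviation e1 where "e1 \<equiv> e1_field M \<phi>"
abbreviation Z :: "'n minkowski" where "Z \<equiv> last_coord_field"

definition alpha :: "'p \<Rightarrow> real" where
  "alpha q = mink Z (\<xi> q)"

text \<open>
  \<open>xi_form p x y\<close> is \<open>\<langle>A\<^sub>\<xi> x, y\<rangle>\<close> for tangent \<open>x\<close> and \<open>y\<close>, and \<open>xi_trace\<close> is the trace of \<open>A\<^sub>\<xi>\<close>,
  written without a frame of \<open>M\<close> so that its smoothness is visible.
\<close>

definition xi_form :: "'p \<Rightarrow> 'n minkowski \<Rightarrow> 'n minkowski \<Rightarrow> real" where
  "xi_form p x y = - mink (D p x \<xi>) y"

definition xi_trace :: "'p \<Rightarrow> real" where
  "xi_trace p = (\<Sum>E\<in>Basis. xi_form p (P p (time_reversal E)) (P p E))"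

lemma imm: "immersed_submanifold M \<phi>"
  using riem by (simp add: riemannian_submanifold_def)

lemma tangent_definite: "p \<in> M \<Longrightarrow> x \<in> T p \<Longrightarrow> mink x x = 0 \<Longrightarrow> x = 0"
  using riem by (force simp: riemannian_submanifold_def)

lemma smooth_xi: "smooth_map M \<phi> \<xi>"
  using xi_field by (simp add: normal_field_def)

lemma xi_normal: "p \<in> M \<Longrightarrow> x \<in> T p \<Longrightarrow> mink (\<xi> p) x = 0"
  using xi_field by (simp add: normal_field_def)

lemma mink_Z_right: "mink v Z = snd (snd v)"
  by (simp add: mink_def last_coord_field_def)

lemma mink_Z: "mink Z Z = 1" "mink (\<theta> q) Z = 0"
  by (simp_all add: mink_def last_coord_field_def theta_field_def)

lemma theta_projection: "\<theta> q = \<phi> q - mink (\<phi> q) Z *\<^sub>R Z"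
  by (simp add: mink_Z_right theta_field_def) (simp add: last_coord_field_def prod_eq_iff)

lemma Z_projection_bounded_linear: "bounded_linear (\<lambda>v. v - mink v Z *\<^sub>R Z)"
  by (intro bounded_linear_sub bounded_linear_ident
      bounded_linear_scaleR_const bounded_bilinear.bounded_linear_left[OF bounded_bilinear_mink])

lemma smooth_theta: "smooth_map M \<phi> \<theta>"
  using smooth_map_bounded_linear[OF Z_projection_bounded_linear smooth_map_position]
  by (rule smooth_map_cong[rotated]) (rule theta_projection[symmetric])

lemma deriv_theta: "x \<in> T p \<Longrightarrow> D p x \<theta> = x - mink x Z *\<^sub>R Z"
  using deriv_along_bounded_linear[OF _ Z_projection_bounded_linear smooth_map_position, of x M \<phi> p]
    deriv_along_position[of x M \<phi> p] by (simp add: ext[OF theta_projection])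

lemma theta_null:
  assumes "p \<in> M"
  shows "mink (\<theta> p) (\<theta> p) = 0"
proof -
  have "\<phi> p \<in> light_cone_cylinder" using assms on_cone by blast
  then show ?thesis
    by (auto simp: light_cone_cylinder_def mink_def theta_field_def power2_eq_square split: prod.splits)
qed

text \<open>Differentiate \<open>\<langle>\<theta>, \<theta>\<rangle> = 0\<close>, using that \<open>Z\<close> is orthogonal to \<open>\<theta>\<close>.\<close>

lemma theta_normal:
  assumes p: "p \<in> M" and x: "x \<in> T p"
  shows "mink (\<theta> p) x = 0"
proof -
  have "D p x (\<lambda>q. mink (\<theta> q) (\<theta> q)) = D p x (\<lambda>q. 0)"
    by (rule deriv_along_cong[OF x smooth_map_const]) (simp add: theta_null)
  then have "mink (\<theta> p) (D p x \<theta>) = 0"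
    using deriv_along_mink[OF x smooth_theta smooth_theta]
    by (simp add: deriv_along_const[OF x] mink_sym)
  then show ?thesis by (simp add: deriv_theta[OF x] mink_simps mink_Z)
qed

text \<open>
  The normal space has dimension two, so the lightlike normal fields \<open>\<theta>\<close> and \<open>\<xi>\<close> span it.
\<close>

lemma tangent_space_eq:
  assumes p: "p \<in> M"
  shows "T p = {w. mink w (\<theta> p) = 0 \<and> mink w (\<xi> p) = 0}"
proof -
  let ?N = "{time_reversal (\<theta> p), time_reversal (\<xi> p)}"
  let ?K = "{w \<in> UNIV. \<forall>x\<in>span ?N. orthogonal x w}"
  have orth: "(\<forall>x\<in>span ?N. orthogonal x w) \<longleftrightarrow> mink w (\<theta> p) = 0 \<and> mink w (\<xi> p) = 0" for w
  proof -
    have "(\<forall>x\<in>span ?N. orthogonal x w) \<longleftrightarrow> (\<forall>x\<in>?N. orthogonal x w)"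
      by (meson orthogonal_commute orthogonal_to_span span_base)
    then show ?thesis by (simp add: orthogonal_def mink_sym flip: mink_eq_inner)
  qed
  have K: "?K = {w. mink w (\<theta> p) = 0 \<and> mink w (\<xi> p) = 0}" using orth by blast
  have rev: "mink (time_reversal v) w = v \<bullet> w" for v w :: "'n minkowski"
    by (simp add: mink_eq_inner) (simp add: time_reversal_def)
  have "independent ?N"
  proof -
    have "mink (\<theta> p) (\<xi> p) \<noteq> 0" using xi_theta[OF p] by (simp add: mink_sym)
    then have nz: "time_reversal (\<theta> p) \<noteq> 0" "time_reversal (\<xi> p) \<noteq> 0"
      by (auto simp: mink_eq_inner mink_sym[of "\<theta> p"])
         (metis inner_zero_left mink_eq_inner mink_sym)
    have "time_reversal (\<theta> p) \<notin> span {time_reversal (\<xi> p)}"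
    proof
      assume "time_reversal (\<theta> p) \<in> span {time_reversal (\<xi> p)}"
      then obtain c where "time_reversal (\<theta> p) = c *\<^sub>R time_reversal (\<xi> p)"
        by (auto simp: span_singleton)
      then have "mink (\<theta> p) (\<xi> p) = c * mink (\<xi> p) (\<xi> p)"
        by (simp add: mink_eq_inner)
      then show False using \<open>mink (\<theta> p) (\<xi> p) \<noteq> 0\<close> xi_null[OF p] by simp
    qed
    then show ?thesis using nz by (simp add: independent_insert)
  qed
  moreover have "time_reversal (\<theta> p) \<noteq> time_reversal (\<xi> p)"
  proof
    assume "time_reversal (\<theta> p) = time_reversal (\<xi> p)"
    then have "mink (\<theta> p) (\<xi> p) = mink (\<xi> p) (\<xi> p)" by (simp add: mink_eq_inner)
    then show False using xi_theta[OF p] xi_null[OF p] by (simp add: mink_sym)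
  qed
  ultimately have "dim (span ?N) = 2"
    by (simp add: dim_span dim_eq_card_independent)
  moreover have "dim ?K + dim (span ?N) = dim (UNIV :: 'n minkowski set)"
    by (rule dim_subspace_orthogonal_to_vectors) auto
  ultimately have "dim ?K = CARD('n)" by simp
  moreover have "subspace ?K"
    unfolding K subspace_def by (auto simp: mink_simps)
  moreover have "T p \<subseteq> ?K"
    unfolding K using theta_normal[OF p] xi_normal[OF p] by (auto simp: mink_sym)
  ultimately have "T p = ?K"
    using subspace_tangent_space[OF imm p] dim_tangent_space[OF imm p]
    by (intro subspace_dim_equal) simp_all
  then show ?thesis by (simp only: K)
qed

lemma tangential_part_eq:
  assumes p: "p \<in> M"
  shows "P p v = v + mink v (\<xi> p) *\<^sub>R \<theta> p + mink v (\<theta> p) *\<^sub>R \<xi> p"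
  unfolding tangential_part_def
proof (rule mink_orth_proj_eqI[OF subspace_tangent_space[OF imm p] tangent_definite[OF p]])
  show "v + mink v (\<xi> p) *\<^sub>R \<theta> p + mink v (\<theta> p) *\<^sub>R \<xi> p \<in> T p"
    using theta_null[OF p] xi_null[OF p] xi_theta[OF p]
    by (simp add: tangent_space_eq[OF p] mink_simps mink_sym[of "\<theta> p" "\<xi> p"])
  show "mink (v - (v + mink v (\<xi> p) *\<^sub>R \<theta> p + mink v (\<theta> p) *\<^sub>R \<xi> p)) x = 0" if "x \<in> T p" for x
    using theta_normal[OF p that] xi_normal[OF p that] by (simp add: mink_simps)
qed

lemma tangential_part_in:
  assumes p: "p \<in> M"
  shows "P p v \<in> T p"
  using theta_null[OF p] xi_null[OF p] xi_theta[OF p]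
  by (simp add: tangential_part_eq[OF p] tangent_space_eq[OF p] mink_simps mink_sym[of "\<theta> p" "\<xi> p"])

lemma mink_tangential_part: "p \<in> M \<Longrightarrow> x \<in> T p \<Longrightarrow> mink (P p v) x = mink v x"
  by (simp add: tangential_part_eq mink_simps theta_normal xi_normal)

lemma tangential_part_tangent: "p \<in> M \<Longrightarrow> x \<in> T p \<Longrightarrow> P p x = x"
  by (simp add: tangential_part_eq tangent_space_eq)

lemma normal_part_eq:
  "p \<in> M \<Longrightarrow> normal_part M \<phi> p v = - mink v (\<xi> p) *\<^sub>R \<theta> p - mink v (\<theta> p) *\<^sub>R \<xi> p"
  by (simp add: normal_part_def tangential_part_eq)

text \<open>
  The second fundamental form needs an extension of every tangent vector to a tangent field on the
  whole of \<open>M\<close>.  Projecting a constant vector field yields one without bump functions, as \<open>\<theta>\<close> and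
  \<open>\<xi>\<close> are globally defined.
\<close>

lemma tangent_field_tangential_part: "tangent_field M \<phi> (\<lambda>q. P q v)"
  unfolding tangent_field_def
proof
  have "smooth_map M \<phi> (\<lambda>q. v + mink v (\<xi> q) *\<^sub>R \<theta> q + mink v (\<theta> q) *\<^sub>R \<xi> q)"
    by (intro smooth_map_add smooth_map_scaleR smooth_map_mink smooth_map_const smooth_xi smooth_theta)
  then show "smooth_map M \<phi> (\<lambda>q. P q v)"
    by (rule smooth_map_cong[rotated]) (simp add: tangential_part_eq)
  show "\<forall>p\<in>M. P p v \<in> T p" by (simp add: tangential_part_in)
qed

lemma tangent_field_e1: "tangent_field M \<phi> e1"
  using tangent_field_tangential_part[of Z] by (simp add: e1_field_def[abs_def])

lemma e1_in: "p \<in> M \<Longrightarrow> e1 p \<in> T p"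
  by (simp add: e1_field_def tangential_part_in)

lemma e1_eq: "p \<in> M \<Longrightarrow> e1 p = Z + alpha p *\<^sub>R \<theta> p"
  by (simp add: e1_field_def tangential_part_eq alpha_def mink_sym[of Z "\<theta> p"] mink_Z)

lemma mink_e1: "p \<in> M \<Longrightarrow> x \<in> T p \<Longrightarrow> mink x (e1 p) = mink x Z"
  by (simp add: mink_sym[of x] e1_field_def mink_tangential_part)

lemma e1_unit: "p \<in> M \<Longrightarrow> mink (e1 p) (e1 p) = 1"
  using mink_e1[OF _ e1_in] by (simp add: e1_eq mink_simps mink_Z)

text \<open>This identifies the given function of the theorem with \<open>\<langle>Z, \<xi>\<rangle>\<close>.\<close>

lemma normal_connection_theta:
  assumes p: "p \<in> M"
  shows "normal_connection M \<phi> \<theta> p (e1 p) = alpha p *\<^sub>R \<theta> p"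
proof -
  have "D p (e1 p) \<theta> = e1 p - Z"
    using deriv_theta[OF e1_in[OF p]] mink_e1[OF p e1_in[OF p]] e1_unit[OF p] by simp
  also have "\<dots> = alpha p *\<^sub>R \<theta> p" using e1_eq[OF p] by simp
  finally show ?thesis
    using theta_null[OF p] xi_theta[OF p]
    by (simp add: normal_connection_def normal_part_eq[OF p] mink_simps mink_sym[of "\<theta> p" "\<xi> p"])
qed

lemma deriv_alpha: "x \<in> T p \<Longrightarrow> D p x alpha = mink Z (D p x \<xi>)"
  unfolding alpha_def[abs_def]
  by (simp add: deriv_along_mink[OF _ smooth_map_const smooth_xi] deriv_along_const mink_simps)

lemma mink_shape_operator:
  "p \<in> M \<Longrightarrow> y \<in> T p \<Longrightarrow> mink (shape_operator M \<phi> \<zeta> p x) y = - mink (D p x \<zeta>) y"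
  by (simp add: shape_operator_def mink_simps mink_tangential_part)

lemma shape_operator_in: "p \<in> M \<Longrightarrow> shape_operator M \<phi> \<zeta> p x \<in> T p"
  using subspace_tangent_space[OF imm] tangential_part_in
  by (simp add: shape_operator_def subspace_neg)

lemma xi_form_bilinear:
  assumes "p \<in> M"
  obtains f where "bilinear f" "\<And>x y. x \<in> T p \<Longrightarrow> xi_form p x y = f x y"
proof -
  obtain d where d: "linear d" "\<And>x. x \<in> T p \<Longrightarrow> D p x \<xi> = d x"
    using deriv_along_linear_direction[OF imm assms smooth_xi] by blast
  have "bilinear (\<lambda>x y. - mink (d x) y)"
    unfolding bilinear_def
    by (intro conjI allI linearI) (simp_all add: mink_simps linear_add[OF d(1)] linear_scale[OF d(1)])
  then show ?thesis using that[of "\<lambda>x y. - mink (d x) y"] d(2) by (simp add: xi_form_def)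
qed

lemma xi_form_sym: "p \<in> M \<Longrightarrow> x \<in> T p \<Longrightarrow> y \<in> T p \<Longrightarrow> xi_form p x y = xi_form p y x"
  by (simp add: xi_form_def normal_field_derivative_symmetric[OF imm _ xi_field])

text \<open>
  Here \<open>e1 = Z + \<alpha> \<theta>\<close> enters: the constant field \<open>Z\<close> contributes the derivative of
  \<open>\<alpha> = \<langle>Z, \<xi>\<rangle>\<close>, and \<open>\<theta>\<close> contributes the quadratic term.
\<close>

lemma xi_form_e1:
  assumes p: "p \<in> M" and x: "x \<in> T p"
  shows "xi_form p x (e1 p) = - (D p x alpha + (alpha p)\<^sup>2 * mink x (e1 p))"
proof -
  have "D p x (\<lambda>q. mink (\<xi> q) (\<theta> q)) = D p x (\<lambda>q. - 1)"
    by (rule deriv_along_cong[OF x smooth_map_const]) (simp add: xi_theta)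
  then have "mink (\<xi> p) (D p x \<theta>) + mink (D p x \<xi>) (\<theta> p) = 0"
    using deriv_along_mink[OF x smooth_xi smooth_theta] by (simp add: deriv_along_const[OF x])
  moreover have "mink (\<xi> p) (D p x \<theta>) = - (mink x (e1 p) * alpha p)"
    using xi_normal[OF p x] mink_e1[OF p x]
    by (simp add: deriv_theta[OF x] mink_simps alpha_def mink_sym[of Z "\<xi> p"])
  ultimately have "mink (D p x \<xi>) (\<theta> p) = mink x (e1 p) * alpha p" by simp
  then show ?thesis
    unfolding xi_form_def e1_eq[OF p]
    by (simp add: deriv_alpha[OF x] mink_simps mink_sym[of "D p x \<xi>" Z] power2_eq_square)
qed

text \<open>
  The components of \<open>h(x, y)\<close> along \<open>\<xi>\<close> and \<open>\<theta>\<close> are, up to sign, its products with \<open>\<theta>\<close> and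
  \<open>\<xi>\<close>.  They come from differentiating \<open>\<langle>\<theta>, Y\<rangle> = 0\<close> and \<open>\<langle>\<xi>, Y\<rangle> = 0\<close>, and only the value of
  \<open>Y\<close> at \<open>p\<close> remains.
\<close>

lemma second_fundamental_form_eq:
  assumes p: "p \<in> M" and x: "x \<in> T p" and y: "y \<in> T p"
  shows "second_fundamental_form M \<phi> p x y =
    (mink x y - mink x (e1 p) * mink y (e1 p)) *\<^sub>R \<xi> p - xi_form p x y *\<^sub>R \<theta> p"
proof -
  define Y where "Y = (SOME Y. tangent_field M \<phi> Y \<and> Y p = y)"
  have "\<exists>Y. tangent_field M \<phi> Y \<and> Y p = y"
    using tangent_field_tangential_part[of y] tangential_part_tangent[OF p y] by blast
  then have Y: "tangent_field M \<phi> Y" "Y p = y"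
    unfolding Y_def by (metis (mono_tags, lifting) someI_ex)+
  have smooth_Y: "smooth_map M \<phi> Y" using Y by (simp add: tangent_field_def)
  have YT: "Y q \<in> T q" if "q \<in> M" for q using Y that by (simp add: tangent_field_def)
  have "D p x (\<lambda>q. mink (\<xi> q) (Y q)) = D p x (\<lambda>q. 0)"
    by (rule deriv_along_cong[OF x smooth_map_const]) (simp add: xi_normal YT)
  then have 1: "mink (D p x Y) (\<xi> p) = xi_form p x y"
    using deriv_along_mink[OF x smooth_xi smooth_Y] Y(2)
    by (simp add: deriv_along_const[OF x] xi_form_def mink_sym[of "D p x Y"])
  have "D p x (\<lambda>q. mink (\<theta> q) (Y q)) = D p x (\<lambda>q. 0)"
    by (rule deriv_along_cong[OF x smooth_map_const]) (simp add: theta_normal YT)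
  then have "mink (D p x Y) (\<theta> p) = - mink (D p x \<theta>) y"
    using deriv_along_mink[OF x smooth_theta smooth_Y] Y(2)
    by (simp add: deriv_along_const[OF x] mink_sym[of "D p x Y"])
  then have 2: "mink (D p x Y) (\<theta> p) = - (mink x y - mink x (e1 p) * mink y (e1 p))"
    by (simp add: deriv_theta[OF x] mink_simps mink_e1[OF p x] mink_e1[OF p y] mink_sym[of Z y])
  show ?thesis
    unfolding second_fundamental_form_def Y_def[symmetric] normal_part_eq[OF p] 1 2
    by (simp add: algebra_simps)
qed

text \<open>
  Smoothness of the trace is what makes the mean curvature vector a differentiable field, so that
  its shape operator can be computed.
\<close>

lemma smooth_xi_trace: "smooth_map M \<phi> xi_trace"
proof -
  have "smooth_map M \<phi> (\<lambda>p. \<Sum>E\<in>Basis. - mink (D p (P p (time_reversal E)) \<xi>) (P p E))"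
    using tangent_field_tangential_part
    by (intro smooth_map_sum smooth_map_bounded_linear[OF bounded_linear_minus[OF bounded_linear_ident]]
        smooth_map_mink smooth_map_deriv_along_field[OF riem _ smooth_xi]) (auto simp: tangent_field_def)
  then show ?thesis by (simp add: xi_trace_def[abs_def] xi_form_def)
qed

lemma sum_xi_form_orthonormal:
  assumes p: "p \<in> M" and b: "mink_orthonormal_basis (T p) {1..n} b"
  shows "(\<Sum>i = 1..n. xi_form p (b i) (b i)) = xi_trace p"
proof -
  obtain f where f: "bilinear f" "\<And>x y. x \<in> T p \<Longrightarrow> xi_form p x y = f x y"
    using xi_form_bilinear[OF p] by blast
  have "(\<Sum>i = 1..n. xi_form p (b i) (b i)) = (\<Sum>i = 1..n. f (b i) (b i))"
    using b f(2) by (intro sum.cong) (auto simp: mink_orthonormal_basis_def)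
  also have "\<dots> = (\<Sum>E\<in>Basis. f (P p (time_reversal E)) (P p E))"
    using mink_trace_eq_ambient_trace[OF f(1) b _ tangential_part_in[OF p] mink_tangential_part[OF p]]
    by simp
  also have "\<dots> = xi_trace p"
    by (simp add: xi_trace_def f(2) tangential_part_in[OF p])
  finally show ?thesis .
qed

lemma mean_curvature_eq:
  assumes p: "p \<in> M" and ex: "\<exists>b. mink_orthonormal_basis (T p) {1..CARD('n)} b"
  shows "mean_curvature M \<phi> p =
    ((real CARD('n) - 1) / real CARD('n)) *\<^sub>R \<xi> p - (xi_trace p / real CARD('n)) *\<^sub>R \<theta> p"
proof -
  let ?n = "CARD('n)"
  define b where "b = (SOME b. mink_orthonormal_basis (T p) {1..?n} b)"
  have b: "mink_orthonormal_basis (T p) {1..?n} b"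
    unfolding b_def by (rule someI_ex[OF ex])
  then have bT: "b i \<in> T p" and bb: "mink (b i) (b i) = 1" if "i \<in> {1..?n}" for i
    using that by (auto simp: mink_orthonormal_basis_def)
  have "mink (e1 p) (e1 p) = mink (\<Sum>i=1..?n. mink (e1 p) (b i) *\<^sub>R b i) (e1 p)"
    using arg_cong[OF mink_orthonormal_expansion[OF b finite_atLeastAtMost e1_in[OF p]],
        of "\<lambda>v. mink v (e1 p)"] .
  then have sq: "(\<Sum>i=1..?n. mink (b i) (e1 p) * mink (b i) (e1 p)) = 1"
    by (simp add: e1_unit[OF p] mink_sum_left mink_simps mink_sym[of "e1 p" "b i" for i])
  have "(\<Sum>i=1..?n. second_fundamental_form M \<phi> p (b i) (b i)) =
      (\<Sum>i=1..?n. (1 - mink (b i) (e1 p) * mink (b i) (e1 p)) *\<^sub>R \<xi> p - xi_form p (b i) (b i) *\<^sub>R \<theta> p)"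
    by (intro sum.cong refl) (simp add: second_fundamental_form_eq[OF p] bT bb)
  also have "\<dots> = (real ?n - 1) *\<^sub>R \<xi> p - xi_trace p *\<^sub>R \<theta> p"
    by (simp add: sum_subtractf sq sum_xi_form_orthonormal[OF p b] del: One_nat_def flip: scaleR_sum_left)
  finally show ?thesis
    unfolding mean_curvature_def Let_def b_def[symmetric]
    by (simp add: scaleR_diff_right divide_inverse mult.commute)
qed

text \<open>
  The derivative of the coefficient of \<open>\<theta>\<close> in \<open>H\<close> only contributes a multiple of \<open>\<theta>\<close>, which is
  normal.
\<close>

lemma shape_operator_mean_curvature:
  assumes p: "p \<in> M" and x: "x \<in> T p" and y: "y \<in> T p"
    and ex: "\<And>q. q \<in> M \<Longrightarrow> \<exists>b. mink_orthonormal_basis (T q) {1..CARD('n)} b"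
  shows "mink (shape_operator M \<phi> (mean_curvature M \<phi>) p x) y =
    ((real CARD('n) - 1) * xi_form p x y +
      xi_trace p * (mink x y - mink x (e1 p) * mink y (e1 p))) / real CARD('n)"
proof -
  let ?c = "(real CARD('n) - 1) / real CARD('n)"
  let ?s = "\<lambda>q. - (xi_trace q / real CARD('n))"
  have smooth_s: "smooth_map M \<phi> ?s"
    using smooth_map_bounded_linear[OF bounded_linear_mult_right[of "- (1 / real CARD('n))"] smooth_xi_trace]
    by simp
  have 1: "smooth_map M \<phi> (\<lambda>q. ?c *\<^sub>R \<xi> q)"
    by (intro smooth_map_scaleR smooth_map_const smooth_xi)
  have 2: "smooth_map M \<phi> (\<lambda>q. ?s q *\<^sub>R \<theta> q)"
    by (intro smooth_map_scaleR smooth_s smooth_theta)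
  have "D p x (mean_curvature M \<phi>) = D p x (\<lambda>q. ?c *\<^sub>R \<xi> q + ?s q *\<^sub>R \<theta> q)"
    by (rule deriv_along_cong[OF x smooth_map_add[OF 1 2]]) (simp add: mean_curvature_eq[OF _ ex])
  also have "\<dots> = ?c *\<^sub>R D p x \<xi> + (?s p *\<^sub>R D p x \<theta> + D p x ?s *\<^sub>R \<theta> p)"
    by (simp only: deriv_along_add[OF x 1 2] deriv_along_scaleR[OF x smooth_s smooth_theta]
        deriv_along_scaleR[OF x smooth_map_const smooth_xi] deriv_along_const[OF x]
        scaleR_zero_left add_0_right)
  finally have DH: "D p x (mean_curvature M \<phi>) =
      ?c *\<^sub>R D p x \<xi> + (?s p *\<^sub>R D p x \<theta> + D p x ?s *\<^sub>R \<theta> p)" .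
  have "mink (shape_operator M \<phi> (mean_curvature M \<phi>) p x) y =
      - (?c * mink (D p x \<xi>) y + ?s p * (mink x y - mink x Z * mink y Z))"
    by (simp add: mink_shape_operator[OF p y] DH mink_simps deriv_theta[OF x] mink_sym[of Z y]
        theta_normal[OF p y])
  also have "\<dots> = ((real CARD('n) - 1) * xi_form p x y +
      xi_trace p * (mink x y - mink x (e1 p) * mink y (e1 p))) / real CARD('n)"
    unfolding mink_e1[OF p x] mink_e1[OF p y] xi_form_def
    by (simp add: divide_simps)
  finally show ?thesis .
qed

lemma subspace_D_perp: "p \<in> M \<Longrightarrow> subspace (D_perp M \<phi> p)"
  using subspace_tangent_space[OF imm, of p]
  by (auto simp: D_perp_def subspace_def mink_simps)

lemma mink_L_operator:
  assumes p: "p \<in> M" and x: "x \<in> T p" and y: "y \<in> D_perp M \<phi> p"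
  shows "mink (L_operator M \<phi> \<xi> p x) y = xi_form p x y"
proof -
  let ?A = "shape_operator M \<phi> \<xi> p x"
  let ?w = "?A - mink ?A (e1 p) *\<^sub>R e1 p"
  have "L_operator M \<phi> \<xi> p x = ?w"
    unfolding L_operator_def
  proof (rule mink_orth_proj_eqI[OF subspace_D_perp[OF p]])
    show "z = 0" if "z \<in> D_perp M \<phi> p" "mink z z = 0" for z
      using that tangent_definite[OF p] by (simp add: D_perp_def)
    show "?w \<in> D_perp M \<phi> p"
      using subspace_tangent_space[OF imm p] shape_operator_in[OF p] e1_in[OF p] e1_unit[OF p]
      by (simp add: D_perp_def subspace_diff subspace_scale mink_simps)
    show "mink (?A - ?w) z = 0" if "z \<in> D_perp M \<phi> p" for z
      using that by (simp add: D_perp_def mink_simps mink_sym[of "e1 p" z])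
  qed
  then show ?thesis
    using y mink_shape_operator[OF p, of y \<xi> x]
    by (simp add: D_perp_def mink_simps mink_sym[of "e1 p" y] xi_form_def)
qed

end

section \<open>Pseudo-umbilical submanifolds of the light cone cylinder\<close>

theorem corollary3p3:
  fixes M :: "'p::topological_space set"
    and \<phi> :: "'p \<Rightarrow> 'n::finite minkowski"
    and \<xi> :: "'p \<Rightarrow> 'n minkowski"
    and e :: "nat \<Rightarrow> 'p \<Rightarrow> 'n minkowski"
    and \<alpha> :: "'p \<Rightarrow> real"
    and \<beta> :: "nat \<Rightarrow> 'p \<Rightarrow> real"
    and n :: nat
  assumes "n = CARD('n)" and "n > 2"
    and "riemannian_submanifold M \<phi>"
    and "\<phi> ` M \<subseteq> light_cone_cylinder"
    and "normal_field M \<phi> \<xi>"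
    and "\<forall>p\<in>M. mink (\<xi> p) (\<xi> p) = 0"
    and "\<forall>p\<in>M. mink (\<xi> p) (theta_field \<phi> p) = - 1"
    and "\<forall>p\<in>M. e 1 p = e1_field M \<phi> p"
    and "smooth_map M \<phi> \<alpha>"
    and "\<forall>p\<in>M. normal_connection M \<phi> (theta_field \<phi>) p (e 1 p) = \<alpha> p *\<^sub>R theta_field \<phi> p"
    and "\<forall>p\<in>M. mink_orthonormal_basis (D_perp M \<phi> p) {2..n} (\<lambda>a. e a p)"
    and "\<forall>p\<in>M. \<forall>a\<in>{2..n}. L_operator M \<phi> \<xi> p (e a p) = \<beta> a p *\<^sub>R e a p"
    and "\<forall>p\<in>M. \<alpha> p \<noteq> 0"
  shows "pseudo_umbilical M \<phi> \<longleftrightarrow>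
    (\<exists>b :: 'p \<Rightarrow> real. \<forall>p\<in>M.
       (\<forall>a\<in>{2..n}. \<beta> a p = b p) \<and>
       deriv_along M \<phi> p (e 1 p) \<alpha> + (\<alpha> p)\<^sup>2 = - ((2 * real n - 2) / (real n - 2)) * b p \<and>
       (\<forall>a\<in>{2..n}. deriv_along M \<phi> p (e a p) \<alpha> = 0))"
proof -
  interpret light_cone_submanifold M \<phi> \<xi>
    by unfold_locales (use assms in auto)
  note n = assms(1,2) and e1 = bspec[OF assms(8)] and Dbasis = bspec[OF assms(11)]
  have theta_nz: "theta_field \<phi> p \<noteq> 0" if "p \<in> M" for p
    using xi_theta[OF that] by (auto simp: mink_simps)
  have alpha_eq: "\<alpha> p = alpha p" if "p \<in> M" for p
  proof -
    have "\<alpha> p *\<^sub>R theta_field \<phi> p = alpha p *\<^sub>R theta_field \<phi> p"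
      using bspec[OF assms(10) that] normal_connection_theta[OF that] e1[OF that] by metis
    then show ?thesis using theta_nz[OF that] by simp
  qed
  have D\<alpha>: "D p x alpha = D p x \<alpha>" if "x \<in> T p" for p x
    by (rule deriv_along_cong[OF that assms(9)]) (simp add: alpha_eq)
  have idx: "{1..n} = insert 1 {2..n}" using n by auto
  have basis: "mink_orthonormal_basis (T p) {1..n} (\<lambda>i. e i p)" if p: "p \<in> M" for p
    unfolding idx
    using mink_orthonormal_basis_insert[OF subspace_tangent_space[OF imm p] e1_in[OF p] e1_unit[OF p],
        of "{2..n}" 1 "\<lambda>i. e i p"] Dbasis[OF p] e1[OF p] by (simp add: D_perp_def)
  have ex: "\<exists>b. mink_orthonormal_basis (T p) {1..CARD('n)} b" if "p \<in> M" for p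
    using basis[OF that] n(1) by blast
  have eT: "e i p \<in> T p" if "p \<in> M" "i \<in> {1..n}" for i p
    using basis[OF that(1)] that(2) by (simp add: mink_orthonormal_basis_def)
  have orth: "mink (e i p) (e j p) = (if i = j then 1 else 0)" if "p \<in> M" "i \<in> {1..n}" "j \<in> {1..n}" for i j p
    using basis[OF that(1)] that(2,3) by (simp add: mink_orthonormal_basis_def)
  define E where "E p = D p (e 1 p) \<alpha> + (\<alpha> p)\<^sup>2" for p
  have form_11: "xi_form p (e 1 p) (e 1 p) = - E p" if p: "p \<in> M" for p
    using xi_form_e1[OF p e1_in[OF p]] e1[OF p] e1_unit[OF p] D\<alpha>[OF e1_in[OF p]] alpha_eq[OF p]
    by (simp add: E_def)
  have form_a1: "xi_form p (e a p) (e 1 p) = - D p (e a p) \<alpha>" if p: "p \<in> M" and a: "a \<in> {2..n}" for p a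
  proof -
    have "e a p \<in> T p" "mink (e a p) (e1 p) = 0"
      using eT[OF p, of a] orth[OF p, of a 1] a e1[OF p] by auto
    then show ?thesis
      using xi_form_e1[OF p, of "e a p"] D\<alpha>[of "e a p" p] e1[OF p] by simp
  qed
  have form_ab: "xi_form p (e a p) (e b p) = (if a = b then \<beta> a p else 0)"
    if p: "p \<in> M" and a: "a \<in> {2..n}" and b: "b \<in> {2..n}" for p a b
  proof -
    have "e b p \<in> D_perp M \<phi> p" using Dbasis[OF p] b by (simp add: mink_orthonormal_basis_def)
    then show ?thesis
      using mink_L_operator[OF p eT[OF p, of a], of "e b p"] assms(12) p a b orth[OF p, of a b]
      by (cases "a = b") (simp_all add: mink_simps)
  qed
  have trace: "xi_trace p = - E p + (\<Sum>a\<in>{2..n}. \<beta> a p)" if p: "p \<in> M" for p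
    using sum_xi_form_orthonormal[OF p basis[OF p]] form_11[OF p] form_ab[OF p]
    by (simp add: idx del: One_nat_def)
  note shape = shape_operator_mean_curvature[OF _ _ _ ex, folded n(1)]
  have N: "real n > 2" using n by simp
  show ?thesis
  proof
    assume "pseudo_umbilical M \<phi>"
    then obtain f where f: "mink (shape_operator M \<phi> (mean_curvature M \<phi>) p x) y = f p * mink x y"
      if "p \<in> M" "x \<in> T p" "y \<in> T p" for p x y
      unfolding pseudo_umbilical_def by blast
    \<comment> \<open>The entry \<open>(a, a)\<close> of the shape operator of \<open>H\<close> equals \<open>f\<close>; solve it for \<open>\<beta>\<^sub>a\<close>.\<close>
    define b where "b p = (real n * f p - xi_trace p) / (real n - 1)" for p
    have "(\<forall>a\<in>{2..n}. \<beta> a p = b p) \<and>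
       E p = - ((2 * real n - 2) / (real n - 2)) * b p \<and> (\<forall>a\<in>{2..n}. D p (e a p) \<alpha> = 0)"
      if p: "p \<in> M" for p
    proof -
      have eq: "((real n - 1) * xi_form p (e i p) (e j p) +
          xi_trace p * (mink (e i p) (e j p) - mink (e i p) (e 1 p) * mink (e j p) (e 1 p))) =
          real n * f p * mink (e i p) (e j p)" if "i \<in> {1..n}" "j \<in> {1..n}" for i j
        using shape[OF p eT[OF p that(1)] eT[OF p that(2)]] f[OF p eT[OF p that(1)] eT[OF p that(2)]]
          N e1[OF p] by (simp add: field_simps)
      have beta: "\<beta> a p = b p" if "a \<in> {2..n}" for a
        using eq[of a a] that orth[OF p, of a a] orth[OF p, of a 1] form_ab[OF p that that] N
        by (simp add: b_def field_simps)
      have "D p (e a p) \<alpha> = 0" if "a \<in> {2..n}" for a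
        using eq[of a 1] that orth[OF p, of a 1] orth[OF p, of 1 1] form_a1[OF p that] N by simp
      moreover have "- ((real n - 1) * E p) = real n * f p"
        using eq[of 1 1] orth[OF p, of 1 1] form_11[OF p] N by simp
      moreover have "xi_trace p = - E p + (real n - 1) * b p"
        using trace[OF p] beta n by (simp add: of_nat_diff)
      moreover have "(real n - 1) * b p = real n * f p - xi_trace p"
        using N by (simp add: b_def)
      ultimately show ?thesis using beta N by (auto simp: field_simps)
    qed
    then show "\<exists>b. \<forall>p\<in>M. (\<forall>a\<in>{2..n}. \<beta> a p = b p) \<and>
       D p (e 1 p) \<alpha> + (\<alpha> p)\<^sup>2 = - ((2 * real n - 2) / (real n - 2)) * b p \<and>
       (\<forall>a\<in>{2..n}. D p (e a p) \<alpha> = 0)"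
      unfolding E_def by blast
  next
    assume "\<exists>b. \<forall>p\<in>M. (\<forall>a\<in>{2..n}. \<beta> a p = b p) \<and>
       D p (e 1 p) \<alpha> + (\<alpha> p)\<^sup>2 = - ((2 * real n - 2) / (real n - 2)) * b p \<and>
       (\<forall>a\<in>{2..n}. D p (e a p) \<alpha> = 0)"
    then obtain b where beta: "\<And>p a. p \<in> M \<Longrightarrow> a \<in> {2..n} \<Longrightarrow> \<beta> a p = b p"
      and Eb: "\<And>p. p \<in> M \<Longrightarrow> E p = - ((2 * real n - 2) / (real n - 2)) * b p"
      and Da: "\<And>p a. p \<in> M \<Longrightarrow> a \<in> {2..n} \<Longrightarrow> D p (e a p) \<alpha> = 0"
      unfolding E_def by blast
    \<comment> \<open>The entry \<open>(1, 1)\<close> dictates this choice, whose smoothness does not rely on the frame.\<close>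
    define f where "f p = - ((real n - 1) / real n) * E p" for p
    have "smooth_map M \<phi> f"
    proof -
      have "smooth_map M \<phi> (\<lambda>p. - ((real n - 1) / real n) * (D p (e1 p) \<alpha> + \<alpha> p * \<alpha> p))"
        by (intro smooth_map_mult smooth_map_const smooth_map_add assms(9)
            smooth_map_deriv_along_field[OF riem tangent_field_e1])
      then show ?thesis
        by (rule smooth_map_cong[rotated]) (use e1 in \<open>auto simp: f_def E_def power2_eq_square\<close>)
    qed
    moreover have "mink (shape_operator M \<phi> (mean_curvature M \<phi>) p x) y = f p * mink x y"
      if p: "p \<in> M" and x: "x \<in> T p" and y: "y \<in> T p" for p x y
    proof -
      obtain g where g: "bilinear g" "\<And>x y. x \<in> T p \<Longrightarrow> xi_form p x y = g x y"
        using xi_form_bilinear[OF p] by blast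
      let ?l = "\<lambda>x y. ((real n - 1) * g x y +
          xi_trace p * (mink x y - mink x (e1 p) * mink y (e1 p))) / real n"
      let ?r = "\<lambda>x y. f p * mink x y"
      have span: "T p = span ((\<lambda>i. e i p) ` {1..n})"
        using basis[OF p] by (simp add: mink_orthonormal_basis_def)
      have lin: "linear (\<lambda>x. g x y)" "linear (\<lambda>y. g x y)" for x y
        using g(1) unfolding bilinear_def by blast+
      have "bilinear ?l"
        unfolding bilinear_def
        by (intro conjI allI linearI)
          (simp_all add: mink_simps linear_add[OF lin(1)] linear_add[OF lin(2)] linear_scale[OF lin(1)]
            linear_scale[OF lin(2)] algebra_simps add_divide_distrib diff_divide_distrib)
      moreover have "bilinear ?r"
        unfolding bilinear_def by (intro conjI allI linearI) (simp_all add: mink_simps algebra_simps)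
      moreover have "?l v w = ?r v w"
        if vw: "v \<in> (\<lambda>i. e i p) ` {1..n}" "w \<in> (\<lambda>i. e i p) ` {1..n}" for v w
      proof -
        obtain i j where ij: "i \<in> {1..n}" "j \<in> {1..n}" "v = e i p" "w = e j p" using vw by blast
        have tr: "xi_trace p = - E p + (real n - 1) * b p"
          using trace[OF p] beta[OF p] n by (simp add: of_nat_diff)
        have "(real n - 1) * b p + xi_trace p = real n * f p"
          using N unfolding tr f_def Eb[OF p] by (simp add: field_simps)
        moreover have "- (real n - 1) * E p = real n * f p"
          using N by (simp add: f_def) (simp add: algebra_simps)
        moreover have "g v w = xi_form p (e i p) (e j p)"
          using g(2)[OF eT[OF p ij(1)]] ij by simp
        \<comment> \<open>The hypotheses give \<open>\<langle>A\<^sub>\<xi> e\<^sub>j, e\<^sub>1\<rangle> = 0\<close>; the transposed entry needs that \<open>A\<^sub>\<xi>\<close> is self-adjoint.\<close>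
        moreover have "xi_form p (e 1 p) (e j p) = 0" if "j \<in> {2..n}" for j
          using xi_form_sym[OF p eT[OF p, of 1] eT[OF p, of j]] that form_a1[OF p that] Da[OF p that] n
          by simp
        ultimately show ?thesis
          using ij(1,2) N unfolding ij(3,4) e1[OF p, symmetric]
          by (cases "i = 1"; cases "j = 1")
            (auto simp: orth[OF p] form_11[OF p] form_a1[OF p] form_ab[OF p] Da[OF p] beta[OF p] field_simps
              simp del: One_nat_def)
      qed
      ultimately have "?l x y = ?r x y"
        using bilinear_eq[of ?l ?r "T p" _ "T p" _ x y] x y span by blast
      then show ?thesis using shape[OF p x y] g(2)[OF x] by simp
    qed
    ultimately show "pseudo_umbilical M \<phi>"
      unfolding pseudo_umbilical_def by blast
  qed
qed

end
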